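(* For every $2<\alpha<3$, there exist rotational axisymmetric $(-\alpha)$-homogeneous solutions of the stationary incompressible Euler equations in $\mathbb{R}^3\setminus\{0\}$ whose stream function level sets are homeomorphic to those of the irrotational axisymmetric $(-3)$-homogeneous solution; that is, the stream function $\psi$ is such that for every $C\in\mathbb{R}$ the level set $\{(z,r):r>0,\ \psi(z,r)=C\}$ is homeomorphic to $\{(z,r):r>0,\ \psi_0(z,r)=C\}$, where $\psi_0=\sin^{2}\theta/(2\rho)$. Such solutions exist in each of the following three classes: (a) Beltrami solutions $(u,p)\in C^{1}(\mathbb{R}^{3}\setminus\{0\})$ with $u^{P},p\in C^{2}(\mathbb{R}^{3}\setminus\{0\})$ and $u^{\phi}e_{\phi}\in C^{1}(\mathbb{R}^{3}\setminus\{0\})$; (b) solutions without swirl $(u,p)\in C^{2}(\mathbb{R}^{3}\setminus\{0\})$; (c) solutions $(u,p)\in C^{1}(\mathbb{R}^{3}\setminus\{0\})$ with a nonconstant Bernoulli function such that $u^{P},p\in C^{2}(\mathbb{R}^{3}\setminus\{0\})$ and $u^{\phi}e_{\phi}\in C^{1}(\mathbb{R}^{3}\setminus\{0\})$.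
   Context: The stationary Euler equations are $u\cdot\nabla u+\nabla p=0$, $\nabla\cdot u=0$. A pair $(u,p)$ is a $(-\alpha)$-homogeneous solution if it solves these equations and, for all $\lambda>0$, $u(x)=\lambda^{\alpha}u(\lambda x)$ and $p(x)=\lambda^{2\alpha}p(\lambda x)$. A solution is rotational if $\nabla\times u$ is not identically zero, Beltrami if $(\nabla\times u)\times u=0$; the Bernoulli function is $\Pi=p+|u|^2/2$. Cylindrical coordinates: $x_1=r\cos\phi$, $x_2=r\sin\phi$, $x_3=z$, with the frame $e_r=(\cos\phi,\sin\phi,0)$, $e_\phi=(-\sin\phi,\cos\phi,0)$, $e_z=(0,0,1)$. A solution is axisymmetric if $u=u^re_r+u^\phi e_\phi+u^ze_z$ with $u^r,u^\phi,u^z,p$ independent of $\phi$; $u^P=u^re_r+u^ze_z$; it is without swirl if $u^\phi=0$. The (axisymmetric) stream function is the function $\psi(z,r)$ with $u^P=\nabla\times(\psi\nabla\phi)=-\frac1r\partial_z\psi\,e_r+\frac1r\partial_r\psi\,e_z$ and $\psi(z,0)=0$; for a $(-\alpha)$-homogeneous solution it is homogeneous of degree $2-\alpha$, i.e. $\psi=w(\cos\theta)/\rho^{\alpha-2}$, where $(\rho,\theta)$ are polar coordinates in the $(z,r)$-half plane: $z=\rho\cos\theta$, $r=\rho\sin\theta$, $0\le\theta\le\pi$. The irrotational axisymmetric $(-3)$-homogeneous solution is $\nabla\times(\psi_0\nabla\phi)$ with $\psi_0=\sin^2\theta/(2\rho)$. *)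

theory Defs
  imports "HOL-Analysis.Analysis"
begin

text \<open>
  Velocity fields and pressures are total functions on \<open>\<real>\<^sup>3\<close> considered on
  \<open>\<real>\<^sup>3 - {0}\<close> only; the value at the origin is never used.
\<close>

abbreviation punctured_space :: "(real^3) set" where
  "punctured_space \<equiv> - {0}"

text \<open>
  \<open>C_k k S f\<close> is meant for open \<open>S\<close>: \<open>f\<close> is \<open>k\<close> times continuously differentiable on \<open>S\<close>.
\<close>

primrec C_k :: "nat \<Rightarrow> 'a::real_normed_vector set \<Rightarrow> ('a \<Rightarrow> 'b::real_normed_vector) \<Rightarrow> bool" where
  "C_k 0 S f \<longleftrightarrow> continuous_on S f"
| "C_k (Suc k) S f \<longleftrightarrow>
     (\<forall>x\<in>S. f differentiable (at x)) \<and>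
     (\<forall>v. C_k k S (\<lambda>x. frechet_derivative f (at x) v))"

definition partial :: "3 \<Rightarrow> (real^3 \<Rightarrow> real) \<Rightarrow> real^3 \<Rightarrow> real" where
  "partial i f x = frechet_derivative f (at x) (axis i 1)"

definition grad :: "(real^3 \<Rightarrow> real) \<Rightarrow> real^3 \<Rightarrow> real^3" where
  "grad f x = (\<chi> i. partial i f x)"

definition divergence :: "(real^3 \<Rightarrow> real^3) \<Rightarrow> real^3 \<Rightarrow> real" where
  "divergence u x = (\<Sum>i\<in>UNIV. partial i (\<lambda>y. u y $ i) x)"

definition curl :: "(real^3 \<Rightarrow> real^3) \<Rightarrow> real^3 \<Rightarrow> real^3" where
  "curl u x = vector
     [partial 2 (\<lambda>y. u y $ 3) x - partial 3 (\<lambda>y. u y $ 2) x,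
      partial 3 (\<lambda>y. u y $ 1) x - partial 1 (\<lambda>y. u y $ 3) x,
      partial 1 (\<lambda>y. u y $ 2) x - partial 2 (\<lambda>y. u y $ 1) x]"

definition convective :: "(real^3 \<Rightarrow> real^3) \<Rightarrow> real^3 \<Rightarrow> real^3" where
  "convective u x = (\<chi> i. \<Sum>j\<in>UNIV. u x $ j * partial j (\<lambda>y. u y $ i) x)"

definition stationary_euler :: "(real^3 \<Rightarrow> real^3) \<Rightarrow> (real^3 \<Rightarrow> real) \<Rightarrow> bool" where
  "stationary_euler u p \<longleftrightarrow>
     (\<forall>x\<in>punctured_space.
        u differentiable (at x) \<and> p differentiable (at x) \<and>
        convective u x + grad p x = 0 \<and> divergence u x = 0)"

definition homogeneous_pair :: "real \<Rightarrow> (real^3 \<Rightarrow> real^3) \<Rightarrow> (real^3 \<Rightarrow> real) \<Rightarrow> bool" where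
  "homogeneous_pair \<alpha> u p \<longleftrightarrow>
     (\<forall>x\<in>punctured_space. \<forall>l>0.
        u x = (l powr \<alpha>) *\<^sub>R u (l *\<^sub>R x) \<and> p x = l powr (2 * \<alpha>) * p (l *\<^sub>R x))"

definition rotational :: "(real^3 \<Rightarrow> real^3) \<Rightarrow> bool" where
  "rotational u \<longleftrightarrow> (\<exists>x\<in>punctured_space. curl u x \<noteq> 0)"

definition beltrami :: "(real^3 \<Rightarrow> real^3) \<Rightarrow> bool" where
  "beltrami u \<longleftrightarrow> (\<forall>x\<in>punctured_space. cross3 (curl u x) (u x) = 0)"

definition bernoulli :: "(real^3 \<Rightarrow> real^3) \<Rightarrow> (real^3 \<Rightarrow> real) \<Rightarrow> real^3 \<Rightarrow> real" where
  "bernoulli u p x = p x + (norm (u x))\<^sup>2 / 2"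

definition cyl_r :: "real^3 \<Rightarrow> real" where
  "cyl_r x = sqrt ((x $ 1)\<^sup>2 + (x $ 2)\<^sup>2)"

text \<open>
  The frame at the point \<open>x\<close>, with \<open>cos \<phi> = x\<^sub>1 / r\<close> and \<open>sin \<phi> = x\<^sub>2 / r\<close>.
  Since \<open>t / 0 = 0\<close>, the vectors \<open>e_r\<close> and \<open>e_phi\<close> vanish on the axis \<open>r = 0\<close>.
  Hence \<open>u\<^sup>r e\<^sub>r\<close> and \<open>u\<^sup>\<phi> e\<^sub>\<phi>\<close> are extended by zero to the axis, which is the only
  possible continuous extension for axisymmetric fields.
\<close>

definition e_r :: "real^3 \<Rightarrow> real^3" where
  "e_r x = vector [x $ 1 / cyl_r x, x $ 2 / cyl_r x, 0]"

definition e_phi :: "real^3 \<Rightarrow> real^3" where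
  "e_phi x = vector [- (x $ 2) / cyl_r x, x $ 1 / cyl_r x, 0]"

definition e_z :: "real^3" where
  "e_z = vector [0, 0, 1]"

text \<open>
  Functions on the half plane take the pair \<open>(z, r)\<close>, in this order.
  On the axis the condition on \<open>u\<close> says that \<open>u\<close> is parallel to \<open>e_z\<close>.
\<close>

definition axisymmetric :: "(real^3 \<Rightarrow> real^3) \<Rightarrow> (real^3 \<Rightarrow> real) \<Rightarrow> bool" where
  "axisymmetric u p \<longleftrightarrow>
     (\<exists>ur uphi uz q :: real \<times> real \<Rightarrow> real. \<forall>x\<in>punctured_space.
        u x = ur (x $ 3, cyl_r x) *\<^sub>R e_r x + uphi (x $ 3, cyl_r x) *\<^sub>R e_phi x
              + uz (x $ 3, cyl_r x) *\<^sub>R e_z \<and>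
        p x = q (x $ 3, cyl_r x))"

definition poloidal :: "(real^3 \<Rightarrow> real^3) \<Rightarrow> real^3 \<Rightarrow> real^3" where
  "poloidal u x = (u x \<bullet> e_r x) *\<^sub>R e_r x + (u x \<bullet> e_z) *\<^sub>R e_z"

definition swirl :: "(real^3 \<Rightarrow> real^3) \<Rightarrow> real^3 \<Rightarrow> real^3" where
  "swirl u x = (u x \<bullet> e_phi x) *\<^sub>R e_phi x"

definition without_swirl :: "(real^3 \<Rightarrow> real^3) \<Rightarrow> bool" where
  "without_swirl u \<longleftrightarrow> (\<forall>x\<in>punctured_space. u x \<bullet> e_phi x = 0)"

text \<open>
  Continuity up to the axis makes the boundary condition \<open>\<psi>(z, 0) = 0\<close> meaningful, so that
  \<open>\<psi>\<close> is determined by \<open>u\<close> on the half plane. The origin is excluded, as a stream function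
  of degree \<open>2 - \<alpha> < 0\<close> is singular there.
\<close>

definition stream_function :: "(real^3 \<Rightarrow> real^3) \<Rightarrow> (real \<times> real \<Rightarrow> real) \<Rightarrow> bool" where
  "stream_function u \<psi> \<longleftrightarrow>
     (\<forall>z r. r > 0 \<longrightarrow> \<psi> differentiable (at (z, r))) \<and>
     (\<forall>x. cyl_r x > 0 \<longrightarrow>
        poloidal u x =
          (- (1 / cyl_r x) * deriv (\<lambda>z. \<psi> (z, cyl_r x)) (x $ 3)) *\<^sub>R e_r x
          + ((1 / cyl_r x) * deriv (\<lambda>r. \<psi> (x $ 3, r)) (cyl_r x)) *\<^sub>R e_z) \<and>
     continuous_on {(z, r). r \<ge> 0 \<and> (z, r) \<noteq> (0, 0)} \<psi> \<and>
     (\<forall>z. z \<noteq> 0 \<longrightarrow> \<psi> (z, 0) = 0)"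

text \<open>\<open>polar_rho\<close> and \<open>polar_theta\<close> invert \<open>z = \<rho> cos \<theta>\<close>, \<open>r = \<rho> sin \<theta>\<close>, \<open>0 \<le> \<theta> \<le> \<pi>\<close>.\<close>

definition polar_rho :: "real \<times> real \<Rightarrow> real" where
  "polar_rho = (\<lambda>(z, r). sqrt (z\<^sup>2 + r\<^sup>2))"

definition polar_theta :: "real \<times> real \<Rightarrow> real" where
  "polar_theta = (\<lambda>(z, r). arccos (z / polar_rho (z, r)))"

definition psi0 :: "real \<times> real \<Rightarrow> real" where
  "psi0 y = (sin (polar_theta y))\<^sup>2 / (2 * polar_rho y)"

definition level_set :: "(real \<times> real \<Rightarrow> real) \<Rightarrow> real \<Rightarrow> (real \<times> real) set" where
  "level_set \<psi> C = {(z, r). r > 0 \<and> \<psi> (z, r) = C}"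

definition dipole_like_solution ::
    "real \<Rightarrow> (real^3 \<Rightarrow> real^3) \<Rightarrow> (real^3 \<Rightarrow> real) \<Rightarrow> bool" where
  "dipole_like_solution \<alpha> u p \<longleftrightarrow>
     stationary_euler u p \<and> homogeneous_pair \<alpha> u p \<and> axisymmetric u p \<and> rotational u \<and>
     (\<exists>\<psi>. stream_function u \<psi> \<and>
        (\<forall>C. level_set \<psi> C homeomorphic level_set psi0 C))"

end

(*
  With beta = alpha - 2 and t = cos theta, write the stream function as psi = w(t) / rho^beta,
  and let the swirl and the Bernoulli function be the powers of psi that homogeneity forces,
  r u^phi = gamma psi^(1 + 1/beta) and Pi = c psi^(2 + 4/beta). The Euler equations reduce to the
  Grad-Shafranov equation
    (1 - t^2) w'' + beta (beta + 1) w + A w^(1 + 2/beta) + B (1 - t^2) w^(1 + 4/beta) = 0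
  with w(-1) = w(1) = 0, and every positive solution gives level sets rho = (w(t) / C)^(1/beta)
  like those of the dipole. For even w this is solved by shooting from the singular end point
  t = 1 to t = 0 with the coefficient A (or B) as shooting parameter: since beta (beta + 1) < 2,
  the linear equation leaves w' on one side, a large coefficient puts it on the other, by
  comparison with 1 - t^2, which solves the equation with beta = 1, A = B = 0.
  B = 0 gives the Beltrami solutions; A = 0 gives solutions without swirl, whose Bernoulli
  function is not constant, so they also belong to class (c).
*)
theory Submission
  imports Defs
begin

section \<open>Calculus of k times continuously differentiable functions\<close>

text \<open>With a single nonlinear term, multiplying \<open>w\<close> by a constant only changes
  the coefficient of that term. So the slope at the end point can be fixed at 1 and the coefficient
  varied, which keeps the zero solution out of the shooting. The main obstacle is the axis, where
  the equation solved for \<open>w''\<close> is singular and the cylindrical frame breaks down. The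
  unknown is therefore the quotient of \<open>w\<close> by its forced zero: \<open>v = w / s\<close>
  with \<open>s = 1 - t\<close> for the existence argument, \<open>V = w / (1 - t^2)\<close>
  afterwards. The fields are written in Cartesian components with coefficients depending on
  \<open>|x|\<close> and \<open>x_3 / |x|\<close>, so that the Euler equations hold on the axis by
  the same identities as off it. Besides the comparison, \<open>\<beta> < 1\<close> decides the
  regularity: the swirl contains \<open>w^(1/\<beta>)\<close> with exponent above 1 only, while all
  powers of \<open>w\<close> in the pressure have exponents above 2.\<close>

lemma C_k_cong:
  assumes "open S" "C_k k S f" "\<And>x. x \<in> S \<Longrightarrow> f x = g x"
  shows "C_k k S g"
  using assms(2,3)
proof (induction k arbitrary: f g)
  case 0
  then show ?case using continuous_on_cong by force
next
  case (Suc k)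
  have D: "(g has_derivative frechet_derivative f (at x)) (at x)" if "x \<in> S" for x
  proof (rule has_derivative_transform_within_open[OF _ \<open>open S\<close> that])
    show "(f has_derivative frechet_derivative f (at x)) (at x)"
      using Suc.prems(1) that frechet_derivative_works by auto
  qed (use Suc.prems in auto)
  have eq: "frechet_derivative g (at x) = frechet_derivative f (at x)" if "x \<in> S" for x
    using frechet_derivative_at[OF D[OF that]] by simp
  have "C_k k S (\<lambda>x. frechet_derivative g (at x) v)" for v
    by (rule Suc.IH[of "\<lambda>x. frechet_derivative f (at x) v"]) (use Suc.prems eq in auto)
  moreover have "g differentiable at x" if "x \<in> S" for x
    using D[OF that] differentiableI by blast
  ultimately show ?case by simp
qed

lemma C_k_SucI:
  assumes "open S" "\<And>x. x \<in> S \<Longrightarrow> (f has_derivative f' x) (at x)"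
    and "\<And>v. C_k k S (\<lambda>x. f' x v)"
  shows "C_k (Suc k) S f"
proof -
  have "C_k k S (\<lambda>x. frechet_derivative f (at x) v)" for v
    by (rule C_k_cong[OF assms(1) assms(3)[of v]]) (use frechet_derivative_at[OF assms(2)] in simp)
  then show ?thesis using assms(2) by (auto intro: differentiableI)
qed

lemma C_k_SucE:
  assumes "C_k (Suc k) S f" "x \<in> S"
  shows "(f has_derivative frechet_derivative f (at x)) (at x)"
  using assms frechet_derivative_works by auto

lemma C_k_Suc_imp:
  "C_k (Suc k) S f \<Longrightarrow> C_k k S f"
proof (induction k arbitrary: f)
  case 0
  then show ?case
    by (auto intro!: continuous_at_imp_continuous_on differentiable_imp_continuous_within)
next
  case (Suc k)
  then show ?case by (metis C_k.simps(2))
qed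

lemma C_k_le: "C_k k S f \<Longrightarrow> j \<le> k \<Longrightarrow> C_k j S f"
  by (induction k) (auto simp: le_Suc_eq dest: C_k_Suc_imp simp del: C_k.simps)

lemma C_k_imp_continuous_on: "C_k k S f \<Longrightarrow> continuous_on S f"
  using C_k_le[of k S f 0] by simp

lemma C_k_subset: "C_k k S f \<Longrightarrow> T \<subseteq> S \<Longrightarrow> C_k k T f"
  by (induction k arbitrary: f) (auto intro: continuous_on_subset)

lemma C_k_Un:
  assumes "open S" "open T" "C_k k S f" "C_k k T f"
  shows "C_k k (S \<union> T) f"
  using assms(3,4) by (induction k arbitrary: f) (auto intro: continuous_on_open_Un assms)

lemma C_k_const: "C_k k S (\<lambda>x. c)"
  by (induction k arbitrary: c) auto

lemma C_k_bounded_linear: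
  assumes "bounded_linear f"
  shows "C_k k S f"
proof (cases k)
  case 0
  then show ?thesis using assms linear_continuous_on by auto
next
  case (Suc j)
  have "(f has_derivative f) (at x)" for x
    using assms bounded_linear_imp_has_derivative by blast
  then have "frechet_derivative f (at x) = f" "f differentiable at x" for x
    using frechet_derivative_at differentiableI by metis+
  then show ?thesis using Suc by (simp add: C_k_const)
qed

lemma C_k_add:
  assumes "open S"
  shows "C_k k S f \<Longrightarrow> C_k k S g \<Longrightarrow> C_k k S (\<lambda>x. f x + g x)"
proof (induction k arbitrary: f g)
  case 0
  then show ?case by (auto intro: continuous_intros)
next
  case (Suc k)
  have "C_k k S (\<lambda>x. frechet_derivative f (at x) v)"
      "C_k k S (\<lambda>x. frechet_derivative g (at x) v)" for v
    using Suc.prems by auto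
  then show ?case
    by (intro C_k_SucI[OF assms has_derivative_add[OF C_k_SucE[OF Suc.prems(1)] C_k_SucE[OF Suc.prems(2)]]] Suc.IH)
qed

lemma C_k_bilinear:
  assumes "open S" "bounded_bilinear B"
  shows "C_k k S f \<Longrightarrow> C_k k S g \<Longrightarrow> C_k k S (\<lambda>x. B (f x) (g x))"
proof (induction k arbitrary: f g)
  case 0
  then show ?case using bounded_bilinear.continuous_on[OF assms(2)] by auto
next
  case (Suc k)
  have "C_k k S f" "C_k k S g" using Suc.prems C_k_Suc_imp by blast+
  moreover have "C_k k S (\<lambda>x. frechet_derivative f (at x) v)"
      "C_k k S (\<lambda>x. frechet_derivative g (at x) v)" for v
    using Suc.prems by auto
  ultimately show ?case
    by (intro C_k_SucI[OF assms(1) bounded_bilinear.FDERIV[OF assms(2)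
            C_k_SucE[OF Suc.prems(1)] C_k_SucE[OF Suc.prems(2)]]] C_k_add[OF assms(1)] Suc.IH)
qed

lemma C_k_mult:
  fixes f g :: "'a::real_normed_vector \<Rightarrow> real"
  assumes "open S" "C_k k S f" "C_k k S g"
  shows "C_k k S (\<lambda>x. f x * g x)"
  by (rule C_k_bilinear[OF assms(1) bounded_bilinear_mult assms(2,3)])

lemma C_k_minus:
  fixes f :: "'a::real_normed_vector \<Rightarrow> real"
  assumes "open S" "C_k k S f"
  shows "C_k k S (\<lambda>x. - f x)"
  using C_k_mult[OF assms(1) C_k_const[of k S "-1"] assms(2)] by simp

lemma C_k_diff:
  fixes f g :: "'a::real_normed_vector \<Rightarrow> real"
  assumes "open S" "C_k k S f" "C_k k S g"
  shows "C_k k S (\<lambda>x. f x - g x)"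
  using C_k_add[OF assms(1,2) C_k_minus[OF assms(1,3)]] by simp

lemma C_k_power:
  fixes f :: "'a::real_normed_vector \<Rightarrow> real"
  assumes "open S" "C_k k S f"
  shows "C_k k S (\<lambda>x. f x ^ n)"
  by (induction n) (auto intro: C_k_const C_k_mult assms)

lemma C_k_real_SucI:
  fixes f f' :: "real \<Rightarrow> real"
  assumes "open S" "\<And>x. x \<in> S \<Longrightarrow> (f has_real_derivative f' x) (at x)" "C_k k S f'"
  shows "C_k (Suc k) S f"
  by (rule C_k_SucI[OF assms(1) assms(2)[unfolded has_field_derivative_def]])
     (auto intro: C_k_mult C_k_const assms)

lemma C_k_compose:
  fixes f :: "'a::real_normed_vector \<Rightarrow> real" and h :: "real \<Rightarrow> real"
  assumes "open S" "open T" "f ` S \<subseteq> T"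
  shows "C_k k T h \<Longrightarrow> C_k k S f \<Longrightarrow> C_k k S (\<lambda>x. h (f x))"
proof (induction k arbitrary: h)
  case 0
  then show ?case using assms(3) continuous_on_compose2 by (metis C_k.simps(1))
next
  case (Suc k)
  \<comment> \<open>On the reals a Frechet derivative is multiplication by its value at 1, so the
    induction can be applied to the scalar function \<open>?h\<close>.\<close>
  let ?h = "\<lambda>y. frechet_derivative h (at y) 1"
  have h: "(h has_derivative (\<lambda>v. v * ?h y)) (at y)" if "y \<in> T" for y
  proof -
    have *: "(h has_derivative frechet_derivative h (at y)) (at y)"
      using C_k_SucE[OF Suc.prems(1) that] .
    have "frechet_derivative h (at y) = (\<lambda>v. v * ?h y)"
    proof
      show "frechet_derivative h (at y) v = v * ?h y" for v
        using linear_cmul[OF has_derivative_linear[OF *], of v 1] by simp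
    qed
    then show ?thesis using * by simp
  qed
  have "C_k k S (\<lambda>x. ?h (f x))"
    by (rule Suc.IH) (use Suc.prems C_k_Suc_imp in auto)
  moreover have "C_k k S (\<lambda>x. frechet_derivative f (at x) v)" for v using Suc.prems by auto
  moreover have "((\<lambda>x. h (f x)) has_derivative
       (\<lambda>v. frechet_derivative f (at x) v * ?h (f x))) (at x)" if "x \<in> S" for x
    using has_derivative_compose[OF C_k_SucE[OF Suc.prems(2) that] h, of] assms(3) that by auto
  ultimately show ?case
    by (intro C_k_SucI[OF assms(1), of _ "\<lambda>x v. frechet_derivative f (at x) v * ?h (f x)"] C_k_mult assms) auto
qed

lemma C_k_vec:
  fixes f :: "'a::real_normed_vector \<Rightarrow> real^'n"
  assumes "open S"
  shows "(\<And>i. C_k k S (\<lambda>x. f x $ i)) \<Longrightarrow> C_k k S f"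
proof (induction k arbitrary: f)
  case 0
  then show ?case using continuous_on_vec_lambda[of S "\<lambda>i x. f x $ i"] by (simp add: vec_lambda_eta)
next
  case (Suc k)
  let ?f = "\<lambda>x v. (\<chi> i. frechet_derivative (\<lambda>x. f x $ i) (at x) v)"
  have "(f has_derivative ?f x) (at x)" if "x \<in> S" for x
    unfolding has_derivative_componentwise_within[of f]
  proof
    fix e :: "real^'n" assume "e \<in> Basis"
    then obtain i where e: "e = axis i 1" by (auto simp: Basis_vec_def)
    show "((\<lambda>x. f x \<bullet> e) has_derivative (\<lambda>v. ?f x v \<bullet> e)) (at x)"
      using C_k_SucE[OF Suc.prems[of i] that] by (simp add: e inner_axis)
  qed
  then show ?case
    by (rule C_k_SucI[OF assms]) (use Suc.prems in \<open>auto intro!: Suc.IH\<close>)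
qed

lemma C_k_powr:
  "C_k k {0<..} (\<lambda>y::real. y powr a)"
proof (induction k arbitrary: a)
  case 0
  then show ?case by (auto intro!: continuous_intros)
next
  case (Suc k)
  show ?case
    by (rule C_k_real_SucI[OF _ _ C_k_mult[OF _ C_k_const[of _ _ a] Suc[of "a - 1"]]])
       (auto intro!: derivative_eq_intros)
qed

text \<open>The profile \<open>w\<close> changes sign at \<open>t = 1\<close> and
  \<open>t = -1\<close>. Cutting the power off at zero keeps it \<open>C_k\<close> through the sign
  change whenever the exponent exceeds k, which gives two-sided derivatives on the axis.\<close>

definition ppow :: "real \<Rightarrow> real \<Rightarrow> real" where
  "ppow a y = max y 0 powr a"

lemma ppow_nonneg [simp]: "ppow a y \<ge> 0" by (simp add: ppow_def)

lemma ppow_nonpos_eq [simp]: "y \<le> 0 \<Longrightarrow> ppow a y = 0" by (simp add: ppow_def)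

lemma ppow_pos: "y > 0 \<Longrightarrow> ppow a y > 0" by (simp add: ppow_def)

lemma ppow_add: "ppow (a + c) y = ppow a y * ppow c y" by (simp add: ppow_def powr_add)

lemma ppow_Suc: "y \<ge> 0 \<Longrightarrow> a > 0 \<Longrightarrow> ppow (1 + a) y = y * ppow a y"
  by (simp add: ppow_def powr_add)

lemma continuous_on_ppow: "a > 0 \<Longrightarrow> continuous_on S (ppow a)"
  unfolding ppow_def by (rule continuous_on_powr') (auto intro!: continuous_intros)

lemma has_derivative_ppow:
  assumes "a > 1"
  shows "(ppow a has_real_derivative a * ppow (a - 1) y) (at y)"
proof (cases "y = 0")
  case True
  \<comment> \<open>At 0 the difference quotient is \<open>ppow (a - 1) h * sgn h\<close>, which
    tends to 0 because \<open>a - 1 > 0\<close>.\<close>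
  have "((\<lambda>h. ppow (a - 1) h * sgn h) \<longlongrightarrow> 0) (at 0)"
  proof (rule Lim_null_comparison)
    have "continuous (at 0) (ppow (a - 1))"
      using continuous_on_ppow[of "a - 1" UNIV] assms by (simp add: continuous_on_eq_continuous_at)
    then show "(ppow (a - 1) \<longlongrightarrow> 0) (at 0)" by (simp add: isCont_def)
    show "\<forall>\<^sub>F h in at 0. norm (ppow (a - 1) h * sgn h) \<le> ppow (a - 1) h"
      by (rule always_eventually) (auto simp: abs_mult sgn_real_def)
  qed
  moreover have "(ppow a (0 + h) - ppow a 0) / h = ppow (a - 1) h * sgn h" if "h \<noteq> 0" for h
    using that by (cases "h > 0") (auto simp: ppow_def powr_diff)
  ultimately have "((\<lambda>h. (ppow a (0 + h) - ppow a 0) / h) \<longlongrightarrow> 0) (at 0)"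
    by (auto intro: Lim_transform_eventually simp: eventually_at_filter)
  then show ?thesis using True by (simp add: DERIV_def)
next
  case False
  show ?thesis
  proof (cases "y > 0")
    case True
    have "((\<lambda>y. y powr a) has_real_derivative a * ppow (a - 1) y) (at y)"
      using True by (auto intro!: derivative_eq_intros simp: ppow_def)
    then show ?thesis
      by (rule has_field_derivative_transform_within_open[where S="{0<..}"])
         (use True in \<open>auto simp: ppow_def\<close>)
  next
    case f: False
    have "((\<lambda>y. 0) has_real_derivative a * ppow (a - 1) y) (at y)"
      using f by auto
    then show ?thesis
      by (rule has_field_derivative_transform_within_open[where S="{..<0}"])
         (use f False in \<open>auto simp: ppow_def\<close>)
  qed
qed

lemma C_k_ppow: "a > real k \<Longrightarrow> C_k k UNIV (ppow a)"
proof (induction k arbitrary: a)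
  case 0
  then show ?case by (simp add: continuous_on_ppow)
next
  case (Suc k)
  have "C_k k UNIV (\<lambda>y. a * ppow (a - 1) y)"
    by (intro C_k_mult C_k_const Suc.IH) (use Suc.prems in auto)
  then show ?case
    by (intro C_k_real_SucI[OF open_UNIV has_derivative_ppow]) (use Suc.prems in auto)
qed

text \<open>The derivative is at most \<open>a\<close> on the half line up to 1. This is what
  truncating \<open>v\<close> at 1 buys: a source that is globally Lipschitz in
  \<open>v\<close>.\<close>

lemma ppow_Lipschitz_unit:
  assumes "a > 1" "x \<le> 1" "y \<le> 1"
  shows "\<bar>ppow a x - ppow a y\<bar> \<le> a * \<bar>x - y\<bar>"
proof -
  have "norm (ppow a x - ppow a y) \<le> a * norm (x - y)"
  proof (rule field_differentiable_bound[of "{..1}"])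
    show "(ppow a has_field_derivative a * ppow (a - 1) z) (at z within {..1})" if "z \<in> {..1}" for z
      using has_derivative_ppow[OF assms(1)] has_field_derivative_at_within by blast
    show "norm (a * ppow (a - 1) z) \<le> a" if "z \<in> {..1}" for z
      using that assms by (auto simp: ppow_def abs_mult powr_le1)
  qed (use assms in auto)
  then show ?thesis by simp
qed

section \<open>A Volterra equation with parameter\<close>

text \<open>The integral of \<open>L |s| exp (2 L |s| \<tau>)\<close> over [0, 1] is
  \<open>(exp (2 L |s|) - 1) / 2\<close>. The 2 in the exponent thus yields a contraction factor 1/2
  in the weighted sup norm, on the whole line at once.\<close>

lemma exp_weighted_integral_bound:
  fixes f :: "real \<Rightarrow> real"
  assumes "L > 0" "D \<ge> 0" "continuous_on {0..1} f"
    and "\<And>\<tau>. \<tau> \<in> {0..1} \<Longrightarrow> \<bar>f \<tau>\<bar> \<le> L * exp (2 * L * \<bar>\<tau> * s\<bar>) * D"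
  shows "\<bar>s * integral {0..1} (\<lambda>\<tau>. (1 - \<tau>) * f \<tau>)\<bar> \<le> D / 2 * exp (2 * L * \<bar>s\<bar>)"
proof -
  let ?g = "\<lambda>\<tau>. \<bar>s\<bar> * (L * exp (2 * L * \<bar>s\<bar> * \<tau>) * D)"
  have "(?g has_integral D / 2 * exp (2 * L * \<bar>s\<bar> * 1) - D / 2 * exp (2 * L * \<bar>s\<bar> * 0)) {0..1}"
    by (rule fundamental_theorem_of_calculus)
       (auto intro!: derivative_eq_intros simp flip: has_real_derivative_iff_has_vector_derivative)
  then have "?g integrable_on {0..1}" "integral {0..1} ?g = D / 2 * exp (2 * L * \<bar>s\<bar> * 1) - D / 2 * exp (2 * L * \<bar>s\<bar> * 0)"
    using integral_unique has_integral_integrable by blast+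
  then have g: "?g integrable_on {0..1}" "integral {0..1} ?g \<le> D / 2 * exp (2 * L * \<bar>s\<bar>)"
    using assms(2) by auto
  have "norm (integral {0..1} (\<lambda>\<tau>. s * ((1 - \<tau>) * f \<tau>))) \<le> integral {0..1} ?g"
  proof (rule integral_norm_bound_integral)
    show "(\<lambda>\<tau>. s * ((1 - \<tau>) * f \<tau>)) integrable_on {0..1}"
      by (rule integrable_continuous_real) (intro continuous_intros assms)
    fix \<tau> :: real assume t: "\<tau> \<in> {0..1}"
    have "\<bar>1 - \<tau>\<bar> * \<bar>f \<tau>\<bar> \<le> 1 * (L * exp (2 * L * \<bar>\<tau> * s\<bar>) * D)"
      by (rule mult_mono) (use t assms(4)[OF t] in auto)
    then show "norm (s * ((1 - \<tau>) * f \<tau>)) \<le> ?g \<tau>"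
      using mult_left_mono[of _ _ "\<bar>s\<bar>"] t by (fastforce simp: abs_mult mult_ac)
  qed (use g in auto)
  then show ?thesis using g by simp
qed

text \<open>
  The contraction acts on \<open>v / exp (2 L |s|)\<close> with \<open>L\<close> depending on the parameter \<open>A\<close>; taking
  \<open>A\<close> as an argument of the unknown function makes the fixed point jointly continuous.
\<close>

lemma volterra_fixed_point:
  fixes F :: "real \<Rightarrow> real \<Rightarrow> real \<Rightarrow> real" and L :: "real \<Rightarrow> real"
  assumes contF: "continuous_on UNIV (\<lambda>(A, s, v). F A s v)"
    and contL: "continuous_on UNIV L" and L: "\<And>A. L A > 0"
    and lip: "\<And>A s x y. \<bar>F A s x - F A s y\<bar> \<le> L A * \<bar>x - y\<bar>"
    and F0: "\<And>A s. F A s 0 = 0"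
  obtains v where "continuous_on UNIV (\<lambda>(A, s). v A s)"
    "\<And>A s. v A s = 1 - s * integral {0..1} (\<lambda>\<tau>. (1 - \<tau>) * F A (\<tau> * s) (v A (\<tau> * s)))"
proof -
  define E where "E A s = exp (2 * L A * \<bar>s\<bar>)" for A s :: real
  have E: "E A s > 0" "E A s \<ge> 1" for A s using L[of A] by (auto simp: E_def)
  have contE: "continuous_on S (\<lambda>x. E (f x) (g x))" if "continuous_on S f" "continuous_on S g"
    for S :: "'a::topological_space set" and f g
    unfolding E_def using that continuous_on_compose2[OF contL that(1)] by (auto intro!: continuous_intros)
  have contF': "continuous_on S (\<lambda>x. F (f x) (g x) (h x))"
    if "continuous_on S f" "continuous_on S g" "continuous_on S h"
    for S :: "'a::topological_space set" and f g h
    using continuous_on_compose2[OF contF, of S "\<lambda>x. (f x, g x, h x)"] that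
    by (simp add: continuous_on_Pair)
  define I where "I \<eta> A s = s * integral {0..1} (\<lambda>\<tau>. (1 - \<tau>) * F A (\<tau> * s) (E A (\<tau> * s) * apply_bcontfun \<eta> (A, \<tau> * s)))" for \<eta> A s
  have cont_\<eta>: "continuous_on S (\<lambda>x. apply_bcontfun \<eta> (f x))" if "continuous_on S f"
    for S :: "'a::topological_space set" and f and \<eta> :: "(real \<times> real) \<Rightarrow>\<^sub>C real"
    using apply_bcontfun[of \<eta>] that by (auto simp: bcontfun_def intro: continuous_on_compose2)
  have contf: "continuous_on S (\<lambda>\<tau>. F A (\<tau> * s) (E A (\<tau> * s) * apply_bcontfun \<eta> (A, \<tau> * s)))" for S \<eta> A s
    by (intro contF' contE cont_\<eta> continuous_intros)
  have contI: "continuous_on UNIV (\<lambda>(A, s). I \<eta> A s)" for \<eta>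
  proof -
    have "continuous_on UNIV (\<lambda>x. integral (cbox 0 1) (\<lambda>\<tau>. (1 - \<tau>) * F (fst x) (\<tau> * snd x) (E (fst x) (\<tau> * snd x) * apply_bcontfun \<eta> (fst x, \<tau> * snd x))))"
      by (rule integral_continuous_on_param)
         (auto simp: case_prod_unfold intro!: contF' contE cont_\<eta> continuous_intros)
    then show ?thesis unfolding I_def case_prod_unfold by (auto intro!: continuous_intros)
  qed
  have boundI: "\<bar>I \<eta> A s\<bar> \<le> norm \<eta> / 2 * E A s" for \<eta> A s
    unfolding I_def E_def[of A s]
  proof (rule exp_weighted_integral_bound[OF L _ contf])
    fix \<tau> :: real
    have "\<bar>F A (\<tau> * s) (E A (\<tau> * s) * apply_bcontfun \<eta> (A, \<tau> * s))\<bar> \<le> L A * \<bar>E A (\<tau> * s) * apply_bcontfun \<eta> (A, \<tau> * s)\<bar>"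
      using lip[of A "\<tau> * s" _ 0] by (simp add: F0)
    also have "\<dots> \<le> L A * (E A (\<tau> * s) * norm \<eta>)"
      using norm_bounded[of \<eta> "(A, \<tau> * s)"] E[of A "\<tau> * s"] L[of A] by (simp add: abs_mult)
    finally show "\<bar>F A (\<tau> * s) (E A (\<tau> * s) * apply_bcontfun \<eta> (A, \<tau> * s))\<bar> \<le> L A * exp (2 * L A * \<bar>\<tau> * s\<bar>) * norm \<eta>"
      by (simp add: E_def mult_ac)
  qed simp
  have diffI: "\<bar>I \<eta> A s - I \<zeta> A s\<bar> \<le> dist \<eta> \<zeta> / 2 * E A s" for \<eta> \<zeta> A s
  proof -
    have "I \<eta> A s - I \<zeta> A s = s * integral {0..1} (\<lambda>\<tau>. (1 - \<tau>) *
        (F A (\<tau> * s) (E A (\<tau> * s) * apply_bcontfun \<eta> (A, \<tau> * s)) - F A (\<tau> * s) (E A (\<tau> * s) * apply_bcontfun \<zeta> (A, \<tau> * s))))"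
      unfolding I_def right_diff_distrib
      by (subst integral_diff)
         (auto intro!: integrable_continuous_real continuous_intros contf simp: right_diff_distrib simp del: times_divide_eq_right)
    also have "\<bar>\<dots>\<bar> \<le> dist \<eta> \<zeta> / 2 * exp (2 * L A * \<bar>s\<bar>)"
    proof (rule exp_weighted_integral_bound[OF L])
      fix \<tau> :: real
      have "\<bar>F A (\<tau> * s) (E A (\<tau> * s) * apply_bcontfun \<eta> (A, \<tau> * s)) - F A (\<tau> * s) (E A (\<tau> * s) * apply_bcontfun \<zeta> (A, \<tau> * s))\<bar>
          \<le> L A * \<bar>E A (\<tau> * s) * apply_bcontfun \<eta> (A, \<tau> * s) - E A (\<tau> * s) * apply_bcontfun \<zeta> (A, \<tau> * s)\<bar>"
        by (rule lip)
      also have "\<dots> = L A * (E A (\<tau> * s) * dist (apply_bcontfun \<eta> (A, \<tau> * s)) (apply_bcontfun \<zeta> (A, \<tau> * s)))"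
        using E[of A "\<tau> * s"] by (simp add: dist_real_def abs_mult flip: right_diff_distrib)
      also have "\<dots> \<le> L A * (E A (\<tau> * s) * dist \<eta> \<zeta>)"
        using dist_bounded[of \<eta> "(A, \<tau> * s)" \<zeta>] E[of A "\<tau> * s"] L[of A] by simp
      finally show "\<bar>F A (\<tau> * s) (E A (\<tau> * s) * apply_bcontfun \<eta> (A, \<tau> * s)) - F A (\<tau> * s) (E A (\<tau> * s) * apply_bcontfun \<zeta> (A, \<tau> * s))\<bar>
          \<le> L A * exp (2 * L A * \<bar>\<tau> * s\<bar>) * dist \<eta> \<zeta>"
        by (simp add: E_def mult_ac)
    qed (auto intro!: continuous_intros contf)
    finally show ?thesis by (simp add: E_def)
  qed
  \<comment> \<open>By \<open>boundI\<close> and \<open>E \<ge> 1\<close> the quotient is bounded by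
    \<open>1 + norm \<eta> / 2\<close>; this makes \<open>Bcontfun\<close> meaningful here.\<close>
  define T where "T \<eta> = Bcontfun (\<lambda>(A, s). (1 - I \<eta> A s) / E A s)" for \<eta>
  have T: "apply_bcontfun (T \<eta>) (A, s) = (1 - I \<eta> A s) / E A s" for \<eta> A s
  proof -
    have "(\<lambda>(A, s). (1 - I \<eta> A s) / E A s) \<in> bcontfun"
    proof (rule bcontfun_normI)
      show "continuous_on UNIV (\<lambda>(A, s). (1 - I \<eta> A s) / E A s)"
        using contI[of \<eta>] E(1) unfolding case_prod_unfold
        by (auto intro!: continuous_intros contE simp: less_imp_neq[symmetric])
      show "norm ((\<lambda>(A, s). (1 - I \<eta> A s) / E A s) x) \<le> 1 + norm \<eta> / 2" for x
      proof -
        obtain A s where x: "x = (A, s)" by force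
        have "\<bar>1 - I \<eta> A s\<bar> \<le> 1 + norm \<eta> / 2 * E A s" using boundI[of \<eta> A s] by linarith
        also have "\<dots> \<le> (1 + norm \<eta> / 2) * E A s" using E(2)[of A s] by (simp add: algebra_simps)
        finally show ?thesis using E(1)[of A s] by (simp add: x pos_divide_le_eq)
      qed
    qed
    then show ?thesis by (simp add: T_def Bcontfun_inverse)
  qed
  have "\<exists>!\<eta>. T \<eta> = \<eta>"
  proof (rule banach_fix_type[of "1/2"])
    show "\<forall>\<eta> \<zeta>. dist (T \<eta>) (T \<zeta>) \<le> 1 / 2 * dist \<eta> \<zeta>"
    proof (intro allI dist_bound)
      fix \<eta> \<zeta> and x :: "real \<times> real"
      obtain A s where x: "x = (A, s)" by force
      have "dist (apply_bcontfun (T \<eta>) x) (apply_bcontfun (T \<zeta>) x) = \<bar>I \<eta> A s - I \<zeta> A s\<bar> / E A s"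
        using E(1)[of A s] by (simp add: x T dist_real_def abs_divide flip: diff_divide_distrib abs_minus_commute)
      also have "\<dots> \<le> 1 / 2 * dist \<eta> \<zeta>"
        using diffI[of \<eta> A s \<zeta>] E(1)[of A s] by (simp add: pos_divide_le_eq mult_ac)
      finally show "dist (apply_bcontfun (T \<eta>) x) (apply_bcontfun (T \<zeta>) x) \<le> 1 / 2 * dist \<eta> \<zeta>" .
    qed
  qed auto
  then obtain \<eta> where \<eta>: "T \<eta> = \<eta>" by auto
  show ?thesis
  proof
    show "continuous_on UNIV (\<lambda>(A, s). E A s * apply_bcontfun \<eta> (A, s))"
      unfolding case_prod_unfold by (intro continuous_intros contE cont_\<eta>)
    show "E A s * apply_bcontfun \<eta> (A, s) = 1 - s * integral {0..1} (\<lambda>\<tau>. (1 - \<tau>) * F A (\<tau> * s) (E A (\<tau> * s) * apply_bcontfun \<eta> (A, \<tau> * s)))" for A s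
      using T[of \<eta> A s, unfolded \<eta>] E(1)[of A s] by (simp add: I_def field_simps)
  qed
qed

text \<open>The integral from 0 to \<open>s\<close>, rescaled to [0, 1], gives one formula for both
  signs of \<open>s\<close>. Near each point it is compared with an antiderivative on a compact
  interval.\<close>

lemma continuous_antiderivative:
  fixes f :: "real \<Rightarrow> real"
  assumes "continuous_on UNIV f"
  obtains g where "g 0 = 0" "\<And>s. (g has_real_derivative f s) (at s)"
proof -
  define g where "g s = s * integral {0..1} (\<lambda>\<tau>. f (\<tau> * s))" for s
  have cf: "continuous_on S f" for S using assms continuous_on_subset by blast
  have "(g has_real_derivative f s) (at s)" for s
  proof -
    define R where "R = \<bar>s\<bar> + 1"
    obtain h where h: "\<And>x. x \<in> {-R..R} \<Longrightarrow> (h has_vector_derivative f x) (at x within {-R..R})"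
      using antiderivative_continuous[OF cf] by blast
    have eq: "g x = h x - h 0" if x: "x \<in> {-R..R}" for x
    proof -
      have "((\<lambda>\<tau>. x * f (\<tau> * x)) has_integral (h (1 * x) - h (0 * x))) {0..1}"
      proof (rule fundamental_theorem_of_calculus)
        fix \<tau> :: real assume \<tau>: "\<tau> \<in> {0..1}"
        have sub: "(\<lambda>\<tau>. \<tau> * x) ` {0..1} \<subseteq> {-R..R}"
        proof clarify
          fix \<tau> :: real assume "\<tau> \<in> {0..1}"
          then have "\<bar>\<tau> * x\<bar> \<le> 1 * R" unfolding abs_mult by (intro mult_mono) (use x in auto)
          then show "\<tau> * x \<in> {-R..R}" by auto
        qed
        have "((h \<circ> (\<lambda>\<tau>. \<tau> * x)) has_vector_derivative x *\<^sub>R f (\<tau> * x)) (at \<tau> within {0..1})"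
        proof (rule vector_diff_chain_within)
          show "((\<lambda>\<tau>. \<tau> * x) has_vector_derivative x) (at \<tau> within {0..1})"
            by (auto intro!: derivative_eq_intros)
          show "(h has_vector_derivative f (\<tau> * x)) (at (\<tau> * x) within (\<lambda>\<tau>. \<tau> * x) ` {0..1})"
            by (rule has_vector_derivative_within_subset[OF h sub]) (use sub \<tau> in blast)
        qed
        then show "((\<lambda>\<tau>. h (\<tau> * x)) has_vector_derivative x * f (\<tau> * x)) (at \<tau> within {0..1})"
          by (simp add: o_def)
      qed simp
      then show ?thesis by (simp add: g_def integral_unique flip: integral_mult_right)
    qed
    have "(h has_vector_derivative f s) (at s)"
      using h[of s] at_within_interior[of s "{-R..R}"] unfolding R_def interior_atLeastAtMost_real
      by (smt (verit) atLeastAtMost_iff greaterThanLessThan_iff)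
    then have "((\<lambda>x. h x - h 0) has_real_derivative f s) (at s)"
      by (auto simp: has_real_derivative_iff_has_vector_derivative intro!: derivative_eq_intros)
    then show ?thesis
      by (rule has_field_derivative_transform_within_open[where S="{-R<..<R}"])
         (auto simp: R_def eq)
  qed
  then show ?thesis using that[of g] by (simp add: g_def)
qed

text \<open>Taylor's formula with integral remainder, rescaled to the unit interval.\<close>

lemma volterra_equation_derivs:
  fixes f v :: "real \<Rightarrow> real"
  assumes f: "continuous_on UNIV f"
    and v: "\<And>s. v s = 1 - s * integral {0..1} (\<lambda>\<tau>. (1 - \<tau>) * f (\<tau> * s))"
  obtains w' where "\<And>s. ((\<lambda>s. s * v s) has_real_derivative w' s) (at s)"
    "\<And>s. (w' has_real_derivative - f s) (at s)" "w' 0 = 1" "v 0 = 1"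
    "w' 1 = 1 - integral {0..1} f"
proof -
  obtain g where g: "g 0 = 0" "\<And>s. (g has_real_derivative f s) (at s)"
    using continuous_antiderivative[OF f] by blast
  have "continuous_on UNIV g" using g(2) DERIV_continuous_on by blast
  then obtain h where h: "h 0 = 0" "\<And>s. (h has_real_derivative g s) (at s)"
    using continuous_antiderivative by blast
  have eq: "s * v s = s - h s" for s
  proof -
    \<comment> \<open>Integration by parts: the integrand is the derivative in \<open>\<tau>\<close>
      of \<open>(1 - \<tau>) s g(\<tau> s) + h(\<tau> s)\<close>, and the boundary terms other than
      \<open>h s\<close> vanish.\<close>
    have "((\<lambda>\<tau>. s * (s * ((1 - \<tau>) * f (\<tau> * s)))) has_integral
        ((1 - 1) * s * g (1 * s) + h (1 * s)) - ((1 - 0) * s * g (0 * s) + h (0 * s))) {0..1}"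
      by (rule fundamental_theorem_of_calculus)
         (auto intro!: derivative_eq_intros DERIV_chain2[OF g(2)] DERIV_chain2[OF h(2)]
           simp: algebra_simps simp flip: has_real_derivative_iff_has_vector_derivative)
    then have "s * (s * integral {0..1} (\<lambda>\<tau>. (1 - \<tau>) * f (\<tau> * s))) = h s"
      by (simp add: integral_unique g h flip: integral_mult_right)
    then show ?thesis unfolding v[of s] by (simp add: algebra_simps)
  qed
  show ?thesis
  proof
    show "((\<lambda>s. s * v s) has_real_derivative 1 - g s) (at s)" for s
      unfolding eq by (auto intro!: derivative_eq_intros h)
    show "((\<lambda>s. 1 - g s) has_real_derivative - f s) (at s)" for s
      by (auto intro!: derivative_eq_intros g)
    have "(f has_integral g 1 - g 0) {0..1}"
      by (rule fundamental_theorem_of_calculus)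
         (auto intro!: has_field_derivative_at_within g simp flip: has_real_derivative_iff_has_vector_derivative)
    then show "1 - g 1 = 1 - integral {0..1} f" using g(1) by (simp add: integral_unique)
  qed (use g(1) v[of 0] in auto)
qed

section \<open>Shooting for the profile\<close>

text \<open>
  The profile equation \<open>w'' + (b w + \<dots>) / (s (2 - s)) = 0\<close>, \<open>w = s v\<close>, started from the singular
  end point \<open>s = 0\<close>. The truncations make the source Lipschitz in \<open>v\<close>; they are inactive on the
  solution that is finally selected.
\<close>

definition source :: "real \<Rightarrow> real \<Rightarrow> (real \<Rightarrow> real) \<Rightarrow> real \<Rightarrow> real \<Rightarrow> real \<Rightarrow> real" where
  "source b m \<kappa> A s v = b / (2 - min s 1) * max v 0 + \<bar>A\<bar> * \<kappa> s * ppow m (min v 1)"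

text \<open>One set of hypotheses for both nonlinearities. With
  \<open>b = \<beta> (\<beta> + 1)\<close> and \<open>w = s v\<close>, division of the profile
  equation by \<open>s (2 - s)\<close> leaves \<open>m = 1 + 2 / \<beta>\<close>,
  \<open>\<kappa> s = s^(m - 1) / (2 - s)\<close> for the swirl term and
  \<open>m = 1 + 4 / \<beta>\<close>, \<open>\<kappa> s = s^m\<close> for the Bernoulli term. On
  [0, 1] the lower bound on \<open>\<kappa>\<close> makes a large \<open>A\<close> bend the
  solution, and the upper bound estimates \<open>\<kappa> v^m\<close> by
  \<open>v w^(m - 1)\<close>.\<close>

locale profile_params =
  fixes b m :: real and \<kappa> :: "real \<Rightarrow> real"
  assumes b: "0 < b" "b < 2" and m: "1 < m"
    and cont_\<kappa>: "continuous_on UNIV \<kappa>"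
    and \<kappa>_range: "0 \<le> \<kappa> s" "\<kappa> s \<le> 1"
    and \<kappa>_nonpos: "s \<le> 0 \<Longrightarrow> \<kappa> s = 0"
    and \<kappa>_bounds: "0 \<le> s \<Longrightarrow> s \<le> 1 \<Longrightarrow> ppow m s / 2 \<le> \<kappa> s"
                  "0 \<le> s \<Longrightarrow> s \<le> 1 \<Longrightarrow> \<kappa> s \<le> ppow (m - 1) s"
begin

lemma source_nonneg: "0 \<le> source b m \<kappa> A s v"
  unfolding source_def using b \<kappa>_range by (auto intro!: add_nonneg_nonneg mult_nonneg_nonneg divide_nonneg_nonneg)

lemma continuous_source: "continuous_on UNIV (\<lambda>(A, s, v). source b m \<kappa> A s v)"
  unfolding source_def case_prod_unfold
  by (intro continuous_intros continuous_on_compose2[OF cont_\<kappa>]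
        continuous_on_compose2[OF continuous_on_ppow[of m UNIV]]) (use m in auto)

lemma abs_mult_diff_left: "0 \<le> (c::real) \<Longrightarrow> \<bar>c * x - c * y\<bar> = c * \<bar>x - y\<bar>"
  by (simp add: abs_mult flip: right_diff_distrib)

lemma source_Lipschitz:
  "\<bar>source b m \<kappa> A s x - source b m \<kappa> A s y\<bar> \<le> (b + \<bar>A\<bar> * m + 1) * \<bar>x - y\<bar>"
proof -
  have "\<bar>b / (2 - min s 1) * max x 0 - b / (2 - min s 1) * max y 0\<bar>
      = b / (2 - min s 1) * \<bar>max x 0 - max y 0\<bar>"
    using b by (intro abs_mult_diff_left divide_nonneg_nonneg) auto
  also have "\<dots> \<le> b * \<bar>x - y\<bar>"
    using b by (intro mult_mono) (auto simp: divide_le_eq)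
  finally have 1: "\<bar>b / (2 - min s 1) * max x 0 - b / (2 - min s 1) * max y 0\<bar> \<le> b * \<bar>x - y\<bar>" .
  have "\<bar>\<bar>A\<bar> * \<kappa> s * ppow m (min x 1) - \<bar>A\<bar> * \<kappa> s * ppow m (min y 1)\<bar>
      = (\<bar>A\<bar> * \<kappa> s) * \<bar>ppow m (min x 1) - ppow m (min y 1)\<bar>"
    using \<kappa>_range by (intro abs_mult_diff_left) auto
  also have "\<dots> \<le> (\<bar>A\<bar> * 1) * (m * \<bar>min x 1 - min y 1\<bar>)"
    using \<kappa>_range m by (intro mult_mono ppow_Lipschitz_unit) auto
  also have "\<dots> \<le> \<bar>A\<bar> * m * \<bar>x - y\<bar>"
    using m by (auto simp: mult.assoc intro!: mult_left_mono)
  finally have "\<bar>\<bar>A\<bar> * \<kappa> s * ppow m (min x 1) - \<bar>A\<bar> * \<kappa> s * ppow m (min y 1)\<bar> \<le> \<bar>A\<bar> * m * \<bar>x - y\<bar>" .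
  from order_trans[OF abs_diff_triangle_ineq add_mono[OF 1 this]]
  have "\<bar>source b m \<kappa> A s x - source b m \<kappa> A s y\<bar> \<le> b * \<bar>x - y\<bar> + \<bar>A\<bar> * m * \<bar>x - y\<bar>"
    by (simp add: source_def)
  also have "\<dots> \<le> (b + \<bar>A\<bar> * m + 1) * \<bar>x - y\<bar>" unfolding distrib_right by simp
  finally show ?thesis .
qed

end

section \<open>Concavity and comparison for the truncated initial value problem\<close>

locale profile = profile_params +
  fixes A :: real and v w' :: "real \<Rightarrow> real"
  assumes A_nonneg: "0 \<le> A"
    and cont_v: "continuous_on UNIV v"
    and deriv_w: "((\<lambda>s. s * v s) has_real_derivative w' s) (at s)"
    and deriv_w': "(w' has_real_derivative - source b m \<kappa> A s (v s)) (at s)"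
    and w'_0: "w' 0 = 1" and v_0: "v 0 = 1"
begin

text \<open>The source is nonnegative whatever the sign of \<open>v\<close>, so
  \<open>s * v s\<close> is concave on the whole line before anything is known about
  positivity.\<close>

lemma w'_antimono: "s \<le> t \<Longrightarrow> w' t \<le> w' s"
proof (rule DERIV_nonpos_imp_nonincreasing[of s t w'])
  fix x
  show "\<exists>y. (w' has_real_derivative y) (at x) \<and> y \<le> 0"
    by (intro exI conjI, rule deriv_w') (simp add: source_nonneg)
qed

text \<open>A concave function lies below its tangent at 0, here the line \<open>s\<close>; dividing
  by \<open>s\<close> gives the bound.\<close>

lemma v_le_1:
  assumes "0 \<le> s"
  shows "v s \<le> 1"
proof -
  have "s * v s - s \<le> 0 * v 0 - 0"
  proof (rule DERIV_nonpos_imp_nonincreasing[OF assms])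
    fix x :: real assume "0 \<le> x"
    then show "\<exists>y. ((\<lambda>s. s * v s - s) has_real_derivative y) (at x) \<and> y \<le> 0"
      using w'_antimono[of 0 x] w'_0
      by (intro exI[of _ "w' x - 1"] conjI DERIV_diff deriv_w DERIV_ident) auto
  qed
  then have "s * (v s - 1) \<le> 0" by (simp add: algebra_simps)
  then show ?thesis using assms v_0 by (cases "s = 0") (auto simp: mult_le_0_iff)
qed

lemma v_ge_1:
  assumes "s \<le> 0"
  shows "1 \<le> v s"
proof -
  have "s * v s - s \<le> 0 * v 0 - 0"
  proof (rule DERIV_nonneg_imp_nondecreasing[OF assms])
    fix x :: real assume "x \<le> 0"
    then show "\<exists>y. ((\<lambda>s. s * v s - s) has_real_derivative y) (at x) \<and> 0 \<le> y"
      using w'_antimono[of x 0] w'_0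
      by (intro exI[of _ "w' x - 1"] conjI DERIV_diff deriv_w DERIV_ident) auto
  qed
  then have "s * (v s - 1) \<le> 0" by (simp add: algebra_simps)
  then show ?thesis using assms v_0 by (cases "s = 0") (auto simp: mult_le_0_iff)
qed

lemma w_mono:
  assumes "0 \<le> w' t" "s \<le> t"
  shows "s * v s \<le> t * v t"
proof (rule DERIV_nonneg_imp_nondecreasing[OF assms(2)])
  fix x assume "x \<le> t"
  then have "0 \<le> w' x" using assms(1) w'_antimono[of x t] by linarith
  then show "\<exists>y. ((\<lambda>s. s * v s) has_real_derivative y) (at x) \<and> 0 \<le> y"
    using deriv_w by blast
qed

text \<open>By concavity a nonnegative slope at \<open>s\<close> means that \<open>s * v s\<close>
  increases up to \<open>s\<close>, and it is positive just to the right of 0.\<close>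

lemma v_pos:
  assumes "0 \<le> w' s" "0 < s"
  shows "0 < v s"
proof -
  have "(v \<longlongrightarrow> v 0) (at 0)"
    using cont_v by (simp add: continuous_on_eq_continuous_at isCont_def)
  then have "eventually (\<lambda>x. 0 < v x) (at 0)"
    by (rule order_tendstoD) (simp add: v_0)
  then obtain d where d: "0 < d" "\<And>x. x \<noteq> 0 \<Longrightarrow> dist x 0 < d \<Longrightarrow> 0 < v x"
    unfolding eventually_at by auto
  define x where "x = min d s / 2"
  have x: "0 < x" "x < s" "0 < v x"
    using d(1) assms(2) d(2)[of x] by (auto simp: x_def dist_real_def)
  have "0 < x * v x" using x by simp
  also have "\<dots> \<le> s * v s" using w_mono[OF assms(1)] x by simp
  finally show ?thesis using assms(2) by (simp add: zero_less_mult_iff)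
qed

text \<open>Sturm comparison with the solution \<open>s (2 - s)\<close> of \<open>w'' + 2 w / (s (2 - s)) = 0\<close>.\<close>

definition wronskian :: "real \<Rightarrow> real" where
  "wronskian s = w' s * (s * (2 - s)) - s * v s * (2 - 2 * s)"

lemma deriv_wronskian:
  "(wronskian has_real_derivative 2 * (s * v s) - source b m \<kappa> A s (v s) * (s * (2 - s))) (at s)"
  unfolding wronskian_def
  by (rule derivative_eq_intros deriv_w deriv_w' refl)+ (simp add: algebra_simps)

text \<open>The singular factor cancels against \<open>s (2 - s)\<close>. What remains is a linear
  term with the positive factor \<open>2 - b\<close> against a nonlinear term of the opposite sign:
  the first decides the case \<open>A = 0\<close>, the second the case of large
  \<open>A\<close>.\<close>

lemma deriv_wronskian_pos:
  assumes "s \<le> 1" "0 \<le> v s"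
  shows "(wronskian has_real_derivative (2 - b) * (s * v s) - A * \<kappa> s * ppow m (min (v s) 1) * (s * (2 - s))) (at s)"
proof -
  have "b / (2 - s) * v s * (s * (2 - s)) = b * (s * v s)" using assms by (simp add: field_simps)
  then show ?thesis
    using deriv_wronskian[of s] assms A_nonneg by (simp add: source_def algebra_simps)
qed

text \<open>The comparison function \<open>s (2 - s)\<close> has slope 0 and value 1 at
  \<open>s = 1\<close>, so \<open>wronskian 1 = w' 1\<close>. For \<open>A = 0\<close> the Wronskian
  starts at 0 and grows as long as \<open>v\<close> is positive, so it suffices to exclude zeros of
  \<open>v\<close>.\<close>

lemma endpoint_slope_pos:
  assumes "A = 0"
  shows "0 < w' 1"
proof -
  have D: "(wronskian has_real_derivative (2 - b) * (s * v s)) (at s)" if "s \<le> 1" "0 \<le> v s" for s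
    using deriv_wronskian_pos[OF that] assms by simp
  have cw: "continuous_on S wronskian" for S
    using deriv_wronskian DERIV_isCont continuous_at_imp_continuous_on by blast
  have nz: "v s \<noteq> 0" if s: "s \<in> {0..1}" for s
  proof
    assume "v s = 0"
    \<comment> \<open>At the first zero \<open>r\<close> of \<open>v\<close> the Wronskian reduces
      to \<open>w' r * (r * (2 - r))\<close>. Its growth forces \<open>w' r \<ge> 0\<close>, and
      then \<open>v_pos\<close> contradicts \<open>v r = 0\<close>.\<close>
    define Z where "Z = {0..1} \<inter> v -` {0}"
    have "compact Z" unfolding Z_def
      by (intro compact_Int_closed compact_Icc continuous_closed_vimage)
         (use cont_v in \<open>auto simp: continuous_on_eq_continuous_at\<close>)
    moreover have "Z \<noteq> {}" using \<open>v s = 0\<close> s by (auto simp: Z_def)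
    ultimately obtain r where r: "r \<in> Z" "\<And>x. x \<in> Z \<Longrightarrow> r \<le> x"
      using compact_attains_inf by metis
    have r0: "0 < r" "r \<le> 1" "v r = 0" using r(1) v_0 by (auto simp: Z_def order_le_less)
    have pos: "0 < v x" if x: "0 \<le> x" "x < r" for x
    proof (rule ccontr)
      assume "\<not> 0 < v x"
      then obtain y where "0 \<le> y" "y \<le> x" "v y = 0"
        using IVT2'[of v x 0 0] x v_0 continuous_on_subset[OF cont_v] by (auto simp: not_less)
      then show False using r(2)[of y] x r0 by (auto simp: Z_def)
    qed
    have "wronskian 0 \<le> wronskian r"
    proof (rule DERIV_nonneg_imp_increasing_open[OF _ _ cw])
      fix x assume "0 < x" "x < r"
      then show "\<exists>y. (wronskian has_real_derivative y) (at x) \<and> 0 \<le> y"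
        using D[of x] pos[of x] r0 b by (intro exI[of _ "(2 - b) * (x * v x)"]) auto
    qed (use r0 in auto)
    then have "0 \<le> w' r * (r * (2 - r))" using r0 by (simp add: wronskian_def)
    moreover have "0 < r * (2 - r)" using r0 by simp
    ultimately have "0 \<le> w' r" by (simp add: zero_le_mult_iff)
    then show False using v_pos[of r] r0 by auto
  qed
  have pos: "0 < v s" if s: "s \<in> {0..1}" for s
  proof (rule ccontr)
    assume "\<not> 0 < v s"
    then obtain y where "0 \<le> y" "y \<le> s" "v y = 0"
      using IVT2'[of v s 0 0] s v_0 continuous_on_subset[OF cont_v] by (auto simp: not_less)
    then show False using nz[of y] s by auto
  qed
  have "wronskian 0 < wronskian 1"
  proof (rule DERIV_pos_imp_increasing_open[OF _ _ cw])
    fix x :: real assume "0 < x" "x < 1"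
    then show "\<exists>y. (wronskian has_real_derivative y) (at x) \<and> 0 < y"
      using D[of x] pos[of x] b by (intro exI[of _ "(2 - b) * (x * v x)"]) auto
  qed auto
  then show ?thesis by (simp add: wronskian_def)
qed

text \<open>\<open>v s\<close> is the mean slope over [0, s] of the concave function
  \<open>s * v s\<close>, hence nonincreasing; this is shown by two applications of the mean value
  theorem.\<close>

lemma v_ge_v1:
  assumes "0 < s" "s \<le> 1"
  shows "v 1 \<le> v s"
proof (cases "s = 1")
  case False
  then have s: "0 < s" "s < 1" using assms by auto
  obtain x where x: "0 < x" "x < s" "s * v s - 0 * v 0 = (s - 0) * w' x"
    using MVT2[of 0 s "\<lambda>s. s * v s" w'] deriv_w s by auto
  obtain y where y: "s < y" "y < 1" "1 * v 1 - s * v s = (1 - s) * w' y"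
    using MVT2[of s 1 "\<lambda>s. s * v s" w'] deriv_w s by auto
  have "v s = w' x" using x s by simp
  moreover have "w' y \<le> w' x" using w'_antimono x y by simp
  ultimately have "v 1 - s * v s \<le> (1 - s) * v s" using y s by simp
  then show ?thesis by (simp add: algebra_simps)
qed simp

text \<open>If the slope at 1 is positive, \<open>s * v s\<close> increases on [0, 1] up to
  \<open>U = v 1\<close>. Comparing the Wronskian at both ends bounds \<open>A U^(m - 1)\<close> by
  \<open>C\<close>. The same product bounds the source, so the solution cannot flatten before a
  height depending only on \<open>C\<close>; this bounds \<open>U\<close> from below and hence
  \<open>A\<close> from above.\<close>

lemma parameter_bound:
  assumes "0 < A" "0 < w' 1"
  defines "C \<equiv> 2 * (m + 2) * (2 - b)"
  shows "A * (1 / (2 * (2 + C))) powr (m - 1) < C"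
proof -
  define U where "U = v 1"
  have w'_pos: "0 < w' s" if "s \<le> 1" for s using w'_antimono[OF that] assms(2) by simp
  have U: "0 < U" using v_pos[of 1] assms(2) by (simp add: U_def)
  have v: "U \<le> v s" "v s \<le> 1" "0 < v s" "s * v s \<le> U" if "0 < s" "s \<le> 1" for s
    using v_ge_v1[OF that] v_le_1[of s] U w_mono[of 1 s] w'_pos[of 1] that by (auto simp: U_def)
  have v0: "0 < v s" if "0 \<le> s" "s \<le> 1" for s using v(3)[of s] v_0 that by (cases "s = 0") auto
  \<comment> \<open>\<open>G\<close> integrates an upper bound for the derivative of the Wronskian,
    obtained from \<open>s v \<le> U\<close>, \<open>v \<ge> U\<close>,
    \<open>\<kappa> \<ge> s^m / 2\<close> and \<open>s (2 - s) \<ge> s\<close>. Then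
    \<open>G 1 > 0\<close> amounts to \<open>A U^(m - 1) < C\<close>.\<close>
  define G where "G s = (2 - b) * U * s - A * ppow m U / 2 * (ppow (m + 2) s / (m + 2))" for s
  have DG: "(G has_real_derivative (2 - b) * U - A * ppow m U / 2 * ppow (m + 1) s) (at s)" for s
  proof -
    have "(ppow (m + 2) has_real_derivative (m + 2) * ppow (m + 1) s) (at s)"
      using has_derivative_ppow[of "m + 2" s] m by (simp add: add.commute add.left_commute)
    from DERIV_cdivide[OF this, of "m + 2"] m
    have "((\<lambda>s. ppow (m + 2) s / (m + 2)) has_real_derivative ppow (m + 1) s) (at s)" by simp
    from DERIV_diff[OF DERIV_cmult_Id DERIV_cmult[OF this]] show ?thesis unfolding G_def .
  qed
  have "wronskian 1 - G 1 \<le> wronskian 0 - G 0"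
  proof (rule DERIV_nonpos_imp_nonincreasing[of 0 1 "\<lambda>s. wronskian s - G s"])
    fix s :: real assume s: "0 \<le> s" "s \<le> 1"
    let ?d = "(2 - b) * (s * v s) - A * \<kappa> s * ppow m (min (v s) 1) * (s * (2 - s)) - ((2 - b) * U - A * ppow m U / 2 * ppow (m + 1) s)"
    have "((\<lambda>s. wronskian s - G s) has_real_derivative ?d) (at s)"
      by (intro DERIV_diff deriv_wronskian_pos DG) (use s v0[of s] in auto)
    moreover have "?d \<le> 0"
    proof (cases "s = 0")
      case True
      then show ?thesis using U b by simp
    next
      case False
      then have s': "0 < s" using s by simp
      have "ppow m U \<le> ppow m (min (v s) 1)"
        using v[OF s' s(2)] U m by (auto simp: ppow_def intro!: powr_mono2)
      then have "A * (ppow m s / 2) * ppow m U * (s * 1) \<le> A * \<kappa> s * ppow m (min (v s) 1) * (s * (2 - s))"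
        using \<kappa>_bounds(1)[OF s] \<kappa>_range s A_nonneg by (intro mult_mono mult_nonneg_nonneg) auto
      moreover have "ppow (m + 1) s = s * ppow m s" using ppow_Suc[of s m] s m by (simp add: add.commute)
      moreover have "(2 - b) * (s * v s) \<le> (2 - b) * U" using v(4)[OF s' s(2)] b by simp
      ultimately show ?thesis by (simp add: algebra_simps)
    qed
    ultimately show "\<exists>y. ((\<lambda>s. wronskian s - G s) has_real_derivative y) (at s) \<and> y \<le> 0" by blast
  qed simp
  then have "w' 1 \<le> G 1" using m by (simp add: wronskian_def G_def)
  then have "0 < (2 - b) * U - A * ppow m U / 2 * (1 / (m + 2))"
    using assms(2) by (simp add: G_def ppow_def)
  moreover have "ppow m U = U * ppow (m - 1) U" using ppow_Suc[of U "m - 1"] U m by simp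
  ultimately have "0 < U * ((2 - b) - A * ppow (m - 1) U / (2 * (m + 2)))" by (simp add: algebra_simps)
  then have "A * ppow (m - 1) U / (2 * (m + 2)) < 2 - b" using U by (simp add: zero_less_mult_iff)
  then have AU: "A * ppow (m - 1) U < C" using m by (simp add: C_def pos_divide_less_eq mult_ac)
  have C: "0 < C" using m b by (simp add: C_def)
  \<comment> \<open>An upper bound for the source: the linear part contributes at most
    \<open>b < 2\<close>, the nonlinear part at most \<open>A U^(m - 1) < C\<close>.\<close>
  define K where "K = 2 + C"
  have K: "K > 2" using C by (simp add: K_def)
  have source_le: "source b m \<kappa> A s (v s) \<le> K" if s: "0 < s" "s \<le> 1" for s
  proof -
    have "\<kappa> s * ppow m (v s) \<le> ppow (m - 1) s * (v s * ppow (m - 1) (v s))"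
      using \<kappa>_bounds(2)[of s] s v[OF s] ppow_Suc[of "v s" "m - 1"] m by (auto intro!: mult_right_mono)
    also have "\<dots> = v s * ppow (m - 1) (s * v s)"
      using s v[OF s] by (simp add: ppow_def powr_mult)
    also have "\<dots> \<le> 1 * ppow (m - 1) U"
      using s v[OF s] U m by (intro mult_mono) (auto simp: ppow_def intro!: powr_mono2)
    finally have "A * (\<kappa> s * ppow m (v s)) \<le> A * ppow (m - 1) U" using assms(1) by simp
    moreover have "b / (2 - s) * v s \<le> b * 1"
      using b s v[OF s] by (intro mult_mono) (auto simp: divide_le_eq)
    moreover have "source b m \<kappa> A s (v s) = b / (2 - s) * v s + A * (\<kappa> s * ppow m (v s))"
      using s v[OF s] assms(1) by (simp add: source_def)
    ultimately show ?thesis using AU b unfolding K_def by linarith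
  qed
  have w'_ge: "1 - K * s \<le> w' s" if "0 \<le> s" "s \<le> 1" for s
  proof -
    have "w' 0 + K * 0 \<le> w' s + K * s"
    proof (rule DERIV_nonneg_imp_increasing_open[OF that(1)])
      show "\<exists>y. ((\<lambda>s. w' s + K * s) has_real_derivative y) (at x) \<and> 0 \<le> y" if "0 < x" "x < s" for x
        using source_le[of x] that \<open>s \<le> 1\<close>
        by (intro exI[of _ "- source b m \<kappa> A x (v x) + K"]) (auto intro!: derivative_eq_intros deriv_w')
      show "continuous_on {0..s} (\<lambda>s. w' s + K * s)"
        by (intro continuous_intros) (use deriv_w' DERIV_isCont continuous_at_imp_continuous_on in blast)
    qed
    then show ?thesis using w'_0 by simp
  qed
  \<comment> \<open>The point \<open>1 / K\<close> maximises the lower bound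
    \<open>s - K s^2 / 2\<close> for \<open>s * v s\<close>, with value
    \<open>1 / (2 K)\<close>.\<close>
  have "0 * v 0 - 0 + K * 0\<^sup>2 / 2 \<le> 1 / K * v (1 / K) - 1 / K + K * (1 / K)\<^sup>2 / 2"
  proof (rule DERIV_nonneg_imp_nondecreasing[of _ _ "\<lambda>s. s * v s - s + K * s\<^sup>2 / 2"])
    fix x assume x: "0 \<le> x" "x \<le> 1 / K"
    have "1 / K \<le> 1" using K by simp
    then show "\<exists>y. ((\<lambda>s. s * v s - s + K * s\<^sup>2 / 2) has_real_derivative y) (at x) \<and> 0 \<le> y"
      using w'_ge[of x] x by (intro exI[of _ "w' x - 1 + K * x"]) (auto intro!: derivative_eq_intros deriv_w[THEN DERIV_cong])
  qed (use K in simp)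
  then have "1 / (2 * K) \<le> 1 / K * v (1 / K)" using K by (simp add: field_simps power2_eq_square)
  also have "\<dots> \<le> U" using v(4)[of "1 / K"] K by simp
  finally have "(1 / (2 * K)) powr (m - 1) \<le> ppow (m - 1) U"
    using K m U by (auto simp: ppow_def intro!: powr_mono2)
  then have "A * (1 / (2 * K)) powr (m - 1) \<le> A * ppow (m - 1) U" using assms(1) by simp
  then show ?thesis using AU by (simp add: K_def)
qed

end

section \<open>Continuous dependence on the parameter and the intermediate value argument\<close>

context profile_params
begin

text \<open>The target \<open>w' 1 = 0\<close> is the condition under which the solution, reflected
  at \<open>s = 1\<close> (that is \<open>t = 0\<close>), has no corner.\<close>

lemma shooting:
  obtains A v w' where "0 < A" "continuous_on UNIV v"
    "\<And>s. ((\<lambda>s. s * v s) has_real_derivative w' s) (at s)"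
    "\<And>s. s \<le> 1 \<Longrightarrow> (w' has_real_derivative - (b / (2 - s) * v s + A * \<kappa> s * ppow m (v s))) (at s)"
    "w' 1 = 0" "v 0 = 1" "\<And>s. s \<le> 1 \<Longrightarrow> 0 < v s"
proof -
  have "continuous_on UNIV (\<lambda>A. b + \<bar>A\<bar> * m + 1)" by (intro continuous_intros)
  moreover have "0 < b + \<bar>A\<bar> * m + 1" for A using b m by (intro add_nonneg_pos) auto
  moreover have "source b m \<kappa> A s 0 = 0" for A s by (simp add: source_def)
  ultimately obtain V where contV: "continuous_on UNIV (\<lambda>(A, s). V A s)"
    and V: "\<And>A s. V A s = 1 - s * integral {0..1} (\<lambda>\<tau>. (1 - \<tau>) * source b m \<kappa> A (\<tau> * s) (V A (\<tau> * s)))"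
    using volterra_fixed_point[OF continuous_source _ _ source_Lipschitz] by blast
  have cV: "continuous_on UNIV (V A)" for A
  proof -
    have "continuous_on UNIV (\<lambda>s::real. (A, s))" by (intro continuous_intros)
    from continuous_on_compose2[OF contV this] show ?thesis by simp
  qed
  have csource: "continuous_on S (\<lambda>x. source b m \<kappa> (f x) (g x) (V (f x) (g x)))"
    if "continuous_on S f" "continuous_on S g" for S :: "'x::topological_space set" and f g
  proof -
    have "continuous_on S (\<lambda>x. V (f x) (g x))"
      using continuous_on_compose2[OF contV, of S "\<lambda>x. (f x, g x)"] that by (auto intro!: continuous_intros)
    then show ?thesis
      using continuous_on_compose2[OF continuous_source, of S "\<lambda>x. (f x, g x, V (f x) (g x))"] that
      by (simp add: continuous_on_Pair)
  qed
  \<comment> \<open>This is the slope at 1, written as an integral so that its continuity in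
    \<open>A\<close> follows from the joint continuity of \<open>V\<close>.\<close>
  define J where "J A = 1 - integral {0..1} (\<lambda>\<sigma>. source b m \<kappa> A \<sigma> (V A \<sigma>))" for A
  have prof: "\<exists>w'. profile b m \<kappa> A (V A) w' \<and> w' 1 = J A" if A: "0 \<le> A" for A
  proof -
    obtain w' where w: "\<And>s. ((\<lambda>s. s * V A s) has_real_derivative w' s) (at s)"
      "\<And>s. (w' has_real_derivative - source b m \<kappa> A s (V A s)) (at s)" "w' 0 = 1" "V A 0 = 1"
      "w' 1 = 1 - integral {0..1} (\<lambda>s. source b m \<kappa> A s (V A s))"
      using volterra_equation_derivs[OF csource[of UNIV "\<lambda>_. A" "\<lambda>s. s"] V[of A]]
      by (auto intro!: continuous_intros)
    have "profile b m \<kappa> A (V A) w'"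
      by unfold_locales (use A w cV in auto)
    then show ?thesis using w J_def by auto
  qed
  have contJ: "continuous_on S J" for S
  proof -
    have "continuous_on S (\<lambda>A. integral (cbox 0 1) (\<lambda>\<sigma>. source b m \<kappa> A \<sigma> (V A \<sigma>)))"
      by (rule integral_continuous_on_param)
         (auto simp: case_prod_unfold intro!: csource continuous_intros)
    then show ?thesis unfolding J_def by (auto intro!: continuous_intros)
  qed
  have J0: "0 < J 0" using prof[of 0] profile.endpoint_slope_pos by fastforce
  define C where "C = 2 * (m + 2) * (2 - b)"
  \<comment> \<open>The value of \<open>A\<close> for which the two sides of
    \<open>parameter_bound\<close> become equal, so the slope at 1 cannot be positive there.\<close>
  define M where "M = C / (1 / (2 * (2 + C))) powr (m - 1)"
  have C: "0 < C" using m b by (simp add: C_def)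
  then have M: "0 < M" by (simp add: M_def)
  have "J M \<le> 0"
  proof (rule ccontr)
    assume "\<not> J M \<le> 0"
    then have "M * (1 / (2 * (2 + C))) powr (m - 1) < C"
      using prof[of M] profile.parameter_bound[of b m \<kappa> M "V M"] M by (fastforce simp: C_def)
    then show False using C by (simp add: M_def)
  qed
  then obtain A where A: "0 \<le> A" "J A = 0"
    using IVT2'[of J M 0 0] J0 M contJ by auto
  then have "0 < A" using J0 by (cases "A = 0") auto
  obtain w' where P: "profile b m \<kappa> A (V A) w'" and w'1: "w' 1 = 0" using prof[OF A(1)] A(2) by auto
  interpret profile b m \<kappa> A "V A" w' by (rule P)
  have pos: "0 < V A s" if "s \<le> 1" for s
  proof (cases "s \<le> 0")
    case True
    then show ?thesis using v_ge_1[of s] by linarith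
  next
    case False
    then show ?thesis using v_pos[of s] w'_antimono[OF that] w'1 by simp
  qed
  \<comment> \<open>For \<open>0 < s \<le> 1\<close> the truncation of \<open>v\<close> is inactive
    by \<open>v_le_1\<close>. For \<open>s \<le> 0\<close> the solution is at least 1, but there
    \<open>\<kappa>\<close> vanishes.\<close>
  have "source b m \<kappa> A s (V A s) = b / (2 - s) * V A s + A * \<kappa> s * ppow m (V A s)" if "s \<le> 1" for s
    using that pos[OF that] v_le_1[of s] \<open>0 < A\<close> \<kappa>_nonpos[of s] by (cases "s \<le> 0") (auto simp: source_def)
  then have "(w' has_real_derivative - (b / (2 - s) * V A s + A * \<kappa> s * ppow m (V A s))) (at s)" if "s \<le> 1" for s
    using deriv_w'[of s] that by simp
  then show ?thesis
    using that[of A "V A" w'] \<open>0 < A\<close> cont_v deriv_w w'1 v_0 pos by blast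
qed

end

section \<open>Regularity of the profile\<close>

lemma tendsto_neg_abs_at_0: "filterlim (\<lambda>h::real. - \<bar>h\<bar>) (at 0) (at 0)"
  unfolding filterlim_at by (auto simp: eventually_at_filter intro!: tendsto_eq_intros)

lemma has_derivative_reflect_even:
  fixes f f' :: "real \<Rightarrow> real"
  assumes f: "\<And>s. s \<le> 1 \<Longrightarrow> (f has_real_derivative f' s) (at s)" and "f' 1 = 0"
  shows "((\<lambda>t. f (1 - \<bar>t\<bar>)) has_real_derivative - sgn t * f' (1 - \<bar>t\<bar>)) (at t)"
proof -
  consider "t > 0" | "t < 0" | "t = 0" by linarith
  then show ?thesis
  proof cases
    case 1
    have "((\<lambda>t. f (1 - t)) has_real_derivative f' (1 - t) * -1) (at t)"
      by (rule DERIV_chain2[OF f]) (use 1 in \<open>auto intro!: derivative_eq_intros\<close>)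
    then have "((\<lambda>t. f (1 - t)) has_real_derivative - sgn t * f' (1 - \<bar>t\<bar>)) (at t)"
      using 1 by simp
    then show ?thesis
      by (rule has_field_derivative_transform_within_open[where S="{0<..}"]) (use 1 in auto)
  next
    case 2
    have "((\<lambda>t. f (1 + t)) has_real_derivative f' (1 + t) * 1) (at t)"
      by (rule DERIV_chain2[OF f]) (use 2 in \<open>auto intro!: derivative_eq_intros\<close>)
    then have "((\<lambda>t. f (1 + t)) has_real_derivative - sgn t * f' (1 - \<bar>t\<bar>)) (at t)"
      using 2 by simp
    then show ?thesis
      by (rule has_field_derivative_transform_within_open[where S="{..<0}"]) (use 2 in auto)
  next
    case 3
    have "(\<lambda>k. (f (1 + k) - f 1) / k) \<midarrow>0\<rightarrow> 0" using f[of 1] assms(2) by (simp add: DERIV_def)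
    then have "(\<lambda>h. (f (1 + - \<bar>h\<bar>) - f 1) / - \<bar>h\<bar>) \<midarrow>0\<rightarrow> 0"
      by (rule filterlim_compose[OF _ tendsto_neg_abs_at_0])
    \<comment> \<open>The quotients with denominators \<open>h\<close> and \<open>-|h|\<close> agree
      up to sign; since the limit is 0, passing to absolute values loses nothing.\<close>
    then have "(\<lambda>h. \<bar>(f (1 + - \<bar>h\<bar>) - f 1) / - \<bar>h\<bar>\<bar>) \<midarrow>0\<rightarrow> 0" by (rule tendsto_rabs_zero)
    then have "(\<lambda>h. \<bar>(f (1 - \<bar>h\<bar>) - f 1) / h\<bar>) \<midarrow>0\<rightarrow> 0" by (simp add: abs_divide)
    then have "(\<lambda>h. (f (1 - \<bar>h\<bar>) - f 1) / h) \<midarrow>0\<rightarrow> 0" by (rule tendsto_rabs_zero_cancel)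
    then show ?thesis using 3 by (simp add: DERIV_def)
  qed
qed

lemma has_derivative_reflect_odd:
  fixes f f' :: "real \<Rightarrow> real"
  assumes f: "\<And>s. s \<le> 1 \<Longrightarrow> (f has_real_derivative f' s) (at s)" and "f 1 = 0"
  shows "((\<lambda>t. - sgn t * f (1 - \<bar>t\<bar>)) has_real_derivative f' (1 - \<bar>t\<bar>)) (at t)"
proof -
  consider "t > 0" | "t < 0" | "t = 0" by linarith
  then show ?thesis
  proof cases
    case 1
    have "((\<lambda>t. f (1 - t)) has_real_derivative f' (1 - t) * -1) (at t)"
      by (rule DERIV_chain2[OF f]) (use 1 in \<open>auto intro!: derivative_eq_intros\<close>)
    from DERIV_minus[OF this]
    have "((\<lambda>t. - f (1 - t)) has_real_derivative f' (1 - \<bar>t\<bar>)) (at t)" using 1 by simp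
    then show ?thesis
      by (rule has_field_derivative_transform_within_open[where S="{0<..}"]) (use 1 in auto)
  next
    case 2
    have "((\<lambda>t. f (1 + t)) has_real_derivative f' (1 + t) * 1) (at t)"
      by (rule DERIV_chain2[OF f]) (use 2 in \<open>auto intro!: derivative_eq_intros\<close>)
    then have "((\<lambda>t. f (1 + t)) has_real_derivative f' (1 - \<bar>t\<bar>)) (at t)" using 2 by simp
    then show ?thesis
      by (rule has_field_derivative_transform_within_open[where S="{..<0}"]) (use 2 in auto)
  next
    case 3
    have "(\<lambda>k. (f (1 + k) - f 1) / k) \<midarrow>0\<rightarrow> f' 1" using f[of 1] by (simp add: DERIV_def)
    then have "(\<lambda>h. (f (1 + - \<bar>h\<bar>) - f 1) / - \<bar>h\<bar>) \<midarrow>0\<rightarrow> f' 1"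
      by (rule filterlim_compose[OF _ tendsto_neg_abs_at_0])
    moreover have "(f (1 + - \<bar>h\<bar>) - f 1) / - \<bar>h\<bar> = - sgn h * f (1 - \<bar>h\<bar>) / h" for h
      using assms(2) by (cases "h > 0"; cases "h = 0") auto
    ultimately show ?thesis using 3 by (simp add: DERIV_def)
  qed
qed

text \<open>The weight \<open>\<tau> ^ n\<close> is there for the induction: each differentiation
  under the integral brings out one more factor \<open>\<tau>\<close>.\<close>

lemma C_k_integral_mean:
  fixes g :: "real \<Rightarrow> real"
  shows "C_k k UNIV g \<Longrightarrow> C_k k UNIV (\<lambda>x. integral {0..1} (\<lambda>\<tau>. \<tau> ^ n * g (c + \<tau> * (x - c))))"
proof (induction k arbitrary: g n)
  case 0
  then have g: "continuous_on UNIV g" by simp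
  have "continuous_on UNIV (\<lambda>x. integral (cbox 0 1) (\<lambda>\<tau>. \<tau> ^ n * g (c + \<tau> * (x - c))))"
    by (rule integral_continuous_on_param)
       (auto simp: case_prod_unfold intro!: continuous_intros continuous_on_compose2[OF g])
  then show ?case by simp
next
  case (Suc k)
  define g' where "g' x = frechet_derivative g (at x) 1" for x
  have g': "(g has_real_derivative g' x) (at x)" for x
  proof -
    have "g differentiable (at x)" using Suc.prems by simp
    then obtain d where d: "(g has_real_derivative d) (at x)"
      by (auto simp: real_differentiable_def)
    then have "frechet_derivative g (at x) = (*) d"
      using frechet_derivative_at[of g "(*) d" x] by (simp add: has_field_derivative_def)
    then have "d = g' x" by (simp add: g'_def)
    then show ?thesis using d by simp
  qed
  have Cg': "C_k k UNIV g'" using Suc.prems unfolding g'_def by simp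
  have cg: "continuous_on UNIV g" "continuous_on UNIV g'"
    using C_k_imp_continuous_on[OF Suc.prems] C_k_imp_continuous_on[OF Cg'] by auto
  show ?case
  proof (rule C_k_real_SucI[OF open_UNIV _ Suc.IH[OF Cg', of "Suc n"]])
    fix x :: real
    have "((\<lambda>x. integral (cbox 0 1) (\<lambda>\<tau>. \<tau> ^ n * g (c + \<tau> * (x - c)))) has_field_derivative
       integral (cbox 0 1) (\<lambda>\<tau>. \<tau> ^ Suc n * g' (c + \<tau> * (x - c)))) (at x within UNIV)"
    proof (rule leibniz_rule_field_derivative)
      show "((\<lambda>x. \<tau> ^ n * g (c + \<tau> * (x - c))) has_real_derivative \<tau> ^ Suc n * g' (c + \<tau> * (y - c))) (at y within UNIV)"
        for y \<tau> :: real
        by (auto intro!: derivative_eq_intros DERIV_chain2[OF g'])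
      show "(\<lambda>\<tau>. \<tau> ^ n * g (c + \<tau> * (y - c))) integrable_on cbox 0 1" for y
        by (rule integrable_continuous) (auto intro!: continuous_intros continuous_on_compose2[OF cg(1)])
      show "continuous_on (UNIV \<times> cbox 0 1) (\<lambda>(x, \<tau>). \<tau> ^ Suc n * g' (c + \<tau> * (x - c)))"
        by (auto simp: case_prod_unfold intro!: continuous_intros continuous_on_compose2[OF cg(2)])
    qed auto
    then show "((\<lambda>x. integral {0..1} (\<lambda>\<tau>. \<tau> ^ n * g (c + \<tau> * (x - c)))) has_real_derivative
       integral {0..1} (\<lambda>\<tau>. \<tau> ^ Suc n * g' (c + \<tau> * (x - c)))) (at x)"
      by simp
  qed
qed

text \<open>Hadamard's lemma: the quotient is the mean of \<open>f'\<close> over the segment from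
  \<open>c\<close> to \<open>x\<close>, so it is as smooth as \<open>f'\<close>.\<close>

lemma C_k_factor_zero:
  fixes f f' :: "real \<Rightarrow> real"
  assumes f': "\<And>x. (f has_real_derivative f' x) (at x)" and C: "C_k k UNIV f'" and "f c = 0"
  obtains q where "C_k k UNIV q" "\<And>x. f x = (x - c) * q x"
proof
  let ?q = "\<lambda>x. integral {0..1} (\<lambda>\<tau>. f' (c + \<tau> * (x - c)))"
  show "C_k k UNIV ?q" using C_k_integral_mean[OF C, of 0 c] by simp
  show "f x = (x - c) * ?q x" for x
  proof -
    have "((\<lambda>\<tau>. (x - c) * f' (c + \<tau> * (x - c))) has_integral f (c + 1 * (x - c)) - f (c + 0 * (x - c))) {0..1}"
    proof (rule fundamental_theorem_of_calculus)
      fix \<tau> :: real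
      have "((\<lambda>\<tau>. f (c + \<tau> * (x - c))) has_real_derivative f' (c + \<tau> * (x - c)) * (x - c)) (at \<tau> within {0..1})"
        by (rule DERIV_chain2[OF f']) (auto intro!: derivative_eq_intros)
      then show "((\<lambda>\<tau>. f (c + \<tau> * (x - c))) has_vector_derivative (x - c) * f' (c + \<tau> * (x - c))) (at \<tau> within {0..1})"
        by (simp add: has_real_derivative_iff_has_vector_derivative mult.commute)
    qed simp
    then show ?thesis using assms(3) by (simp add: integral_unique flip: integral_mult_right)
  qed
qed

text \<open>Dividing \<open>(1 - t^2) V\<close> by its zeros costs one derivative. Only the zero at
  1 is divided out, which settles \<open>t > -1\<close>; evenness carries the result over to
  \<open>t < 1\<close>.\<close>

lemma C_k_quotient_even:
  fixes V :: "real \<Rightarrow> real"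
  assumes even: "\<And>t. V (- t) = V t" and cont: "continuous_on UNIV V"
    and w: "\<And>t. ((\<lambda>t. (1 - t\<^sup>2) * V t) has_real_derivative w1 t) (at t)"
    and C: "C_k k UNIV w1"
  shows "C_k k UNIV V"
proof -
  obtain q where q: "C_k k UNIV q" "\<And>t. (1 - t\<^sup>2) * V t = (t - 1) * q t"
    using C_k_factor_zero[OF w C, of 1] by auto
  let ?Q = "\<lambda>t. - (q t * (1 + t) powr (-1))"
  have CQ: "C_k k {-1<..} ?Q"
  proof (intro C_k_minus C_k_mult)
    show "C_k k {-1<..} q" using q(1) C_k_subset by blast
    show "C_k k {-1<..} (\<lambda>t::real. (1 + t) powr -1)"
      by (rule C_k_compose[OF _ _ _ C_k_powr C_k_add[OF _ C_k_const C_k_bounded_linear[OF bounded_linear_ident]]]) auto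
  qed auto
  have eq: "?Q t = V t" if t: "t > -1" "t \<noteq> 1" for t
  proof -
    have "(1 + t) * V t = - q t"
    proof -
      have "(t - 1) * ((1 + t) * V t + q t) = 0"
        using q(2)[of t] by (simp add: algebra_simps power2_eq_square)
      then have "(1 + t) * V t + q t = 0" using t(2) by simp
      then show ?thesis by linarith
    qed
    then show ?thesis using t by (simp add: powr_minus field_simps)
  qed
  have "isCont ?Q 1"
    by (rule continuous_on_interior[OF C_k_imp_continuous_on[OF CQ]]) (simp add: interior_open)
  then have "?Q \<midarrow>1\<rightarrow> ?Q 1" unfolding isCont_def .
  moreover have "eventually (\<lambda>t. ?Q t = V t) (at 1)"
  proof -
    have "eventually (\<lambda>t::real. t \<in> {-1<..}) (at 1)" by (rule eventually_at_in_open') auto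
    then show ?thesis using eventually_neq_at_within[of 1 1 UNIV]
      by eventually_elim (use eq in auto)
  qed
  ultimately have "V \<midarrow>1\<rightarrow> ?Q 1" by (rule Lim_transform_eventually)
  moreover have "V \<midarrow>1\<rightarrow> V 1" using cont by (simp add: continuous_on_eq_continuous_at isCont_def)
  ultimately have "?Q 1 = V 1" using LIM_unique by blast
  then have "?Q t = V t" if "t \<in> {-1<..}" for t
    using eq[of t] that by (cases "t = 1") (simp_all only: greaterThan_iff not_False_eq_True simp_thms)
  then have CV: "C_k k {-1<..} V" by (intro C_k_cong[OF _ CQ]) simp_all
  have "C_k k {..<1} (\<lambda>t. V (- t))"
    by (rule C_k_compose[OF _ _ _ CV C_k_minus[OF _ C_k_bounded_linear[OF bounded_linear_ident]]]) auto
  then have "C_k k {..<1} V" using even by simp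
  with CV have "C_k k ({-1<..} \<union> {..<1}) V" by (intro C_k_Un) auto
  moreover have "{-1<..} \<union> {..<1} = (UNIV :: real set)" by auto
  ultimately show ?thesis by simp
qed

text \<open>
  The stream function is \<open>\<psi> = w(t) / \<rho>\<^sup>\<beta>\<close> with \<open>t = cos \<theta>\<close>, \<open>\<beta> = \<alpha> - 2\<close> and
  \<open>w = (1 - t\<^sup>2) V\<close>; the equation for \<open>w''\<close> is the Grad-Shafranov equation divided by \<open>1 - t\<^sup>2\<close>.
  The \<open>A\<close> term comes from the swirl, the \<open>B\<close> term from the Bernoulli function. The profile is
  kept on all of \<open>\<real>\<close>, beyond \<open>|t| \<le> 1\<close>, so that it can be differentiated at \<open>t = \<plusminus>1\<close>.
\<close>

locale euler_profile =
  fixes \<beta> A B :: real and V V' w' :: "real \<Rightarrow> real"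
  assumes \<beta>: "0 < \<beta>" "\<beta> < 1" and AB: "0 \<le> A" "0 \<le> B" "0 < A + B"
    and V_pos: "0 < V t"
    and deriv_V: "(V has_real_derivative V' t) (at t)"
    and deriv_w: "((\<lambda>t. (1 - t\<^sup>2) * V t) has_real_derivative w' t) (at t)"
    and deriv_w': "(w' has_real_derivative
      - (\<beta> * (\<beta> + 1) * V t + A * V t * ppow (2 / \<beta>) ((1 - t\<^sup>2) * V t)
         + B * ppow (1 + 4 / \<beta>) ((1 - t\<^sup>2) * V t))) (at t)"
    and C_k_V: "C_k 2 UNIV V" and C_k_w': "C_k 2 UNIV w'"

text \<open>A bootstrap: smoothness of \<open>V\<close> passes to the right side of the equation,
  \<open>w'\<close> is one order better, and \<open>V\<close> inherits the order of
  \<open>w'\<close> by \<open>C_k_quotient_even\<close>. Two rounds lead from continuous to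
  \<open>C_k 2\<close>.\<close>

lemma euler_profileI:
  assumes \<beta>: "0 < \<beta>" "\<beta> < 1" and AB: "0 \<le> A" "0 \<le> B" "0 < A + B"
    and V_pos: "\<And>t. 0 < V t" and even: "\<And>t. V (- t) = V t" and contV: "continuous_on UNIV V"
    and w: "\<And>t. ((\<lambda>t. (1 - t\<^sup>2) * V t) has_real_derivative w' t) (at t)"
    and w': "\<And>t. (w' has_real_derivative
      - (\<beta> * (\<beta> + 1) * V t + A * V t * ppow (2 / \<beta>) ((1 - t\<^sup>2) * V t)
         + B * ppow (1 + 4 / \<beta>) ((1 - t\<^sup>2) * V t))) (at t)"
  obtains V' where "euler_profile \<beta> A B V V' w'"
proof -
  let ?w = "\<lambda>t. (1 - t\<^sup>2) * V t"
  let ?w2 = "\<lambda>t. - (\<beta> * (\<beta> + 1) * V t + A * V t * ppow (2 / \<beta>) (?w t) + B * ppow (1 + 4 / \<beta>) (?w t))"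
  have "real 1 < 2 / \<beta>" "real 1 < 1 + 4 / \<beta>" using \<beta> by (auto simp: field_simps)
  then have pp: "C_k 1 UNIV (ppow (2 / \<beta>))" "C_k 1 UNIV (ppow (1 + 4 / \<beta>))"
    by (intro C_k_ppow; simp)+
  have C_w2: "C_k k UNIV ?w2" if V: "C_k k UNIV V" and "k \<le> 1" for k
  proof -
    have "C_k k UNIV ?w"
      by (rule C_k_mult[OF open_UNIV C_k_diff[OF open_UNIV C_k_const C_k_power[OF open_UNIV
              C_k_bounded_linear[OF bounded_linear_ident]]] V])
    note comp = C_k_compose[OF open_UNIV open_UNIV subset_UNIV _ this]
    have "C_k k UNIV (\<lambda>t. ppow (2 / \<beta>) (?w t))" "C_k k UNIV (\<lambda>t. ppow (1 + 4 / \<beta>) (?w t))"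
      by (rule comp[OF C_k_le[OF pp(1) \<open>k \<le> 1\<close>]], rule comp[OF C_k_le[OF pp(2) \<open>k \<le> 1\<close>]])
    then show ?thesis
      by (intro C_k_minus C_k_add open_UNIV C_k_mult[OF open_UNIV C_k_mult[OF open_UNIV C_k_const V]]
            C_k_mult[OF open_UNIV C_k_const] V)
  qed
  have "C_k 0 UNIV ?w2" using contV by (intro C_w2) auto
  then have "C_k 1 UNIV w'" using C_k_real_SucI[OF open_UNIV w'] by (simp only: One_nat_def)
  then have "C_k 1 UNIV V" by (rule C_k_quotient_even[OF even contV w])
  then have "C_k 1 UNIV ?w2" by (intro C_w2) auto
  then have Cw': "C_k 2 UNIV w'" using C_k_real_SucI[OF open_UNIV w'] by (simp only: numeral_2_eq_2 One_nat_def)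
  then have CV: "C_k 2 UNIV V" by (rule C_k_quotient_even[OF even contV w])
  have "\<exists>d. (V has_real_derivative d) (at t)" for t
  proof -
    have "V differentiable (at t)" using CV by (simp add: numeral_2_eq_2)
    then show ?thesis by (simp add: real_differentiable_def)
  qed
  then obtain V' where "\<And>t. (V has_real_derivative V' t) (at t)" by metis
  then have "euler_profile \<beta> A B V V' w'"
    by (intro euler_profile.intro \<beta> AB V_pos w w' Cw' CV)
  then show ?thesis by (rule that)
qed

section \<open>Even profiles for the two nonlinearities\<close>

lemma ppow_mult: "0 \<le> y \<Longrightarrow> ppow a (x * y) = ppow a x * ppow a y"
  by (cases "0 \<le> x") (auto simp: ppow_def powr_mult max_def mult_le_0_iff)

lemma ppow_le_1: "0 \<le> a \<Longrightarrow> x \<le> 1 \<Longrightarrow> ppow a x \<le> 1"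
  by (auto simp: ppow_def powr_le1)

lemma (in profile_params) even_profile:
  obtains A V w' where "0 < A" "\<And>t. 0 < V t" "\<And>t. V (- t) = V t" "continuous_on UNIV V"
    "\<And>t. ((\<lambda>t. (1 - t\<^sup>2) * V t) has_real_derivative w' t) (at t)"
    "\<And>t. (w' has_real_derivative
       - (b * V t + A * \<kappa> (1 - \<bar>t\<bar>) * ppow m ((1 + \<bar>t\<bar>) * V t))) (at t)"
proof -
  obtain A v w' where A: "0 < A" and cv: "continuous_on UNIV v"
    and w: "\<And>s. ((\<lambda>s. s * v s) has_real_derivative w' s) (at s)"
    and w': "\<And>s. s \<le> 1 \<Longrightarrow> (w' has_real_derivative - (b / (2 - s) * v s + A * \<kappa> s * ppow m (v s))) (at s)"
    and w'1: "w' 1 = 0" and v: "\<And>s. s \<le> 1 \<Longrightarrow> 0 < v s"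
    by (rule shooting) blast
  \<comment> \<open>With \<open>s = 1 - |t|\<close> one has \<open>1 - t^2 = s (1 + |t|)\<close>, so
    \<open>(1 - t^2) V\<close> is the shooting solution \<open>s * v s\<close> reflected
    evenly.\<close>
  define V where "V t = v (1 - \<bar>t\<bar>) / (1 + \<bar>t\<bar>)" for t
  have Vv: "(1 + \<bar>t\<bar>) * V t = v (1 - \<bar>t\<bar>)" for t by (simp add: V_def)
  show ?thesis
  proof (rule that[of A V "\<lambda>t. - sgn t * w' (1 - \<bar>t\<bar>)"])
    show "0 < V t" for t using v by (simp add: V_def add_pos_nonneg)
    show "V (- t) = V t" for t by (simp add: V_def)
    show "continuous_on UNIV V" unfolding V_def
      by (intro continuous_intros continuous_on_compose2[OF cv]) auto
    have "(1 - t\<^sup>2) * V t = (1 - \<bar>t\<bar>) * v (1 - \<bar>t\<bar>)" for t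
    proof -
      have "1 - t\<^sup>2 = (1 - \<bar>t\<bar>) * (1 + \<bar>t\<bar>)" by (simp add: algebra_simps power2_eq_square)
      then show ?thesis by (simp add: mult.assoc Vv)
    qed
    then show "((\<lambda>t. (1 - t\<^sup>2) * V t) has_real_derivative - sgn t * w' (1 - \<bar>t\<bar>)) (at t)" for t
      using has_derivative_reflect_even[OF w w'1] by simp
    have "b / (2 - (1 - \<bar>t\<bar>)) * v (1 - \<bar>t\<bar>) = b * V t" for t
      by (simp add: V_def)
    then show "((\<lambda>t. - sgn t * w' (1 - \<bar>t\<bar>)) has_real_derivative
       - (b * V t + A * \<kappa> (1 - \<bar>t\<bar>) * ppow m ((1 + \<bar>t\<bar>) * V t))) (at t)" for t
      using has_derivative_reflect_odd[OF w' w'1, of t] by (simp add: Vv)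
  qed (fact A)
qed

lemma euler_profile_swirl_exists:
  assumes "0 < \<beta>" "\<beta> < 1"
  obtains A V V' w' where "0 < A" "euler_profile \<beta> A 0 V V' w'"
proof -
  define m where "m = 1 + 2 / \<beta>"
  \<comment> \<open>From \<open>w^m / (s (2 - s)) = s^(m - 1) / (2 - s) * v^m\<close> for
    \<open>w = s v\<close>. The minimum keeps the denominator at least 1 for all
    \<open>s\<close>.\<close>
  define \<kappa> where "\<kappa> s = ppow (m - 1) (min s 1) / (2 - min s 1)" for s :: real
  have m: "1 < m - 1" "m - 1 = 2 / \<beta>" "1 < m" using assms by (auto simp: m_def field_simps)
  have "profile_params (\<beta> * (\<beta> + 1)) m \<kappa>"
  proof
    show "0 < \<beta> * (\<beta> + 1)" "\<beta> * (\<beta> + 1) < 2"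
      using assms mult_strict_mono[of \<beta> 1 "\<beta> + 1" 2] by auto
    show "1 < m" using m by blast
    show "continuous_on UNIV \<kappa>" unfolding \<kappa>_def
      by (intro continuous_intros continuous_on_compose2[OF continuous_on_ppow[of "m - 1" UNIV]]) (use m assms in auto)
    show "0 \<le> \<kappa> s" for s unfolding \<kappa>_def by (rule divide_nonneg_nonneg) auto
    have den: "1 \<le> 2 - min s 1" for s :: real by simp
    have "\<kappa> s \<le> ppow (m - 1) (min s 1) / 1" for s
      unfolding \<kappa>_def by (rule divide_left_mono) (use den[of s] in auto)
    moreover have "ppow (m - 1) (min s 1) \<le> 1" for s using m(3) by (intro ppow_le_1) (linarith | simp)+
    ultimately show "\<kappa> s \<le> 1" for s by (metis div_by_1 order_trans)
    show "\<kappa> s \<le> ppow (m - 1) s" if "0 \<le> s" "s \<le> 1" for s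
      using \<open>\<And>s. \<kappa> s \<le> ppow (m - 1) (min s 1) / 1\<close>[of s] that by simp
    show "\<kappa> s = 0" if "s \<le> 0" for s using that by (simp add: \<kappa>_def)
    show "ppow m s / 2 \<le> \<kappa> s" if s: "0 \<le> s" "s \<le> 1" for s
    proof -
      have "ppow m s = s * ppow (m - 1) s" using ppow_Suc[of s "m - 1"] s(1) m(1) by simp
      then have "ppow m s \<le> ppow (m - 1) s" using s mult_right_mono[of s 1 "ppow (m - 1) s"] by simp
      then have "ppow m s / 2 \<le> ppow (m - 1) s / (2 - s)" using s by (intro frac_le) auto
      then show ?thesis using s by (simp add: \<kappa>_def)
    qed
  qed
  then obtain A V w' where A: "0 < A" and V: "\<And>t. 0 < V t" "\<And>t. V (- t) = V t" "continuous_on UNIV V"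
    and w: "\<And>t. ((\<lambda>t. (1 - t\<^sup>2) * V t) has_real_derivative w' t) (at t)"
    "\<And>t. (w' has_real_derivative
       - (\<beta> * (\<beta> + 1) * V t + A * \<kappa> (1 - \<bar>t\<bar>) * ppow m ((1 + \<bar>t\<bar>) * V t))) (at t)"
    by (rule profile_params.even_profile) blast
  \<comment> \<open>For \<open>|t| \<ge> 1\<close> both sides vanish, as \<open>ppow\<close> is
    applied to a nonpositive number on each.\<close>
  have eq: "A * \<kappa> (1 - \<bar>t\<bar>) * ppow m ((1 + \<bar>t\<bar>) * V t) = A * V t * ppow (2 / \<beta>) ((1 - t\<^sup>2) * V t)" for t
  proof -
    have "1 - t\<^sup>2 = (1 - \<bar>t\<bar>) * (1 + \<bar>t\<bar>)" by (simp add: algebra_simps power2_eq_square)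
    then have "ppow (2 / \<beta>) ((1 - t\<^sup>2) * V t) = ppow (m - 1) (1 - \<bar>t\<bar>) * ppow (m - 1) ((1 + \<bar>t\<bar>) * V t)"
      using ppow_mult[of "(1 + \<bar>t\<bar>) * V t" "m - 1" "1 - \<bar>t\<bar>"] V(1)[of t] m by (simp add: mult.assoc)
    moreover have "ppow m ((1 + \<bar>t\<bar>) * V t) = (1 + \<bar>t\<bar>) * V t * ppow (m - 1) ((1 + \<bar>t\<bar>) * V t)"
      using ppow_Suc[of "(1 + \<bar>t\<bar>) * V t" "m - 1"] V(1)[of t] m(1) by simp
    moreover have "1 + \<bar>t\<bar> \<noteq> 0" by linarith
    ultimately show ?thesis by (simp add: \<kappa>_def field_simps)
  qed
  obtain V' where "euler_profile \<beta> A 0 V V' w'"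
    by (rule euler_profileI[OF assms, of A 0 V w']) (use A V w eq in auto)
  then show ?thesis using that A by blast
qed

lemma euler_profile_no_swirl_exists:
  assumes "0 < \<beta>" "\<beta> < 1"
  obtains B V V' w' where "0 < B" "euler_profile \<beta> 0 B V V' w'"
proof -
  define m where "m = 1 + 4 / \<beta>"
  \<comment> \<open>Here the factor \<open>1 - t^2\<close> of the Bernoulli term cancels, and
    \<open>w^m = s^m v^m\<close>.\<close>
  define \<kappa> where "\<kappa> s = ppow m (min s 1)" for s :: real
  have m: "1 < m" using assms by (auto simp: m_def field_simps)
  have "profile_params (\<beta> * (\<beta> + 1)) m \<kappa>"
  proof
    show "0 < \<beta> * (\<beta> + 1)" "\<beta> * (\<beta> + 1) < 2"
      using assms mult_strict_mono[of \<beta> 1 "\<beta> + 1" 2] by auto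
    show "1 < m" using m by blast
    show "continuous_on UNIV \<kappa>" unfolding \<kappa>_def
      by (intro continuous_intros continuous_on_compose2[OF continuous_on_ppow[of m UNIV]]) (use m in auto)
    show "0 \<le> \<kappa> s" "\<kappa> s \<le> 1" for s unfolding \<kappa>_def using m by (auto intro: ppow_le_1)
    show "\<kappa> s = 0" if "s \<le> 0" for s using that by (simp add: \<kappa>_def)
    show "ppow m s / 2 \<le> \<kappa> s" if s: "0 \<le> s" "s \<le> 1" for s using s by (simp add: \<kappa>_def)
    show "\<kappa> s \<le> ppow (m - 1) s" if s: "0 \<le> s" "s \<le> 1" for s
    proof -
      have "ppow m s = s * ppow (m - 1) s" using ppow_Suc[of s "m - 1"] s m by simp
      then show ?thesis using s mult_right_mono[of s 1 "ppow (m - 1) s"] by (simp add: \<kappa>_def)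
    qed
  qed
  then obtain B V w' where B: "0 < B" and V: "\<And>t. 0 < V t" "\<And>t. V (- t) = V t" "continuous_on UNIV V"
    and w: "\<And>t. ((\<lambda>t. (1 - t\<^sup>2) * V t) has_real_derivative w' t) (at t)"
    "\<And>t. (w' has_real_derivative
       - (\<beta> * (\<beta> + 1) * V t + B * \<kappa> (1 - \<bar>t\<bar>) * ppow m ((1 + \<bar>t\<bar>) * V t))) (at t)"
    by (rule profile_params.even_profile) blast
  have eq: "B * \<kappa> (1 - \<bar>t\<bar>) * ppow m ((1 + \<bar>t\<bar>) * V t) = B * ppow (1 + 4 / \<beta>) ((1 - t\<^sup>2) * V t)" for t
  proof -
    have "1 - t\<^sup>2 = (1 - \<bar>t\<bar>) * (1 + \<bar>t\<bar>)" by (simp add: algebra_simps power2_eq_square)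
    then show ?thesis
      using ppow_mult[of "(1 + \<bar>t\<bar>) * V t" m "1 - \<bar>t\<bar>"] V(1)[of t] by (simp add: m_def \<kappa>_def mult.assoc)
  qed
  obtain V' where "euler_profile \<beta> 0 B V V' w'"
    by (rule euler_profileI[OF assms, of 0 B V w']) (use B V w eq in auto)
  then show ?thesis using that B by blast
qed

section \<open>Axisymmetric homogeneous fields and level sets\<close>

text \<open>The gradient of an axisymmetric function with \<open>z\<close> the axial derivative and
  \<open>q\<close> the radial derivative divided by \<open>r\<close>. With this quotient as data the
  formula makes sense on the axis.\<close>

definition axi_deriv :: "(real^3 \<Rightarrow> real) \<Rightarrow> real \<Rightarrow> real \<Rightarrow> real^3 \<Rightarrow> bool" where
  "axi_deriv f q z x \<longleftrightarrow> (f has_derivative (\<lambda>v. (x $ 1 * v $ 1 + x $ 2 * v $ 2) * q + v $ 3 * z)) (at x)"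

text \<open>The field with \<open>u^r = - r R\<close>, \<open>u^\<phi> = r g\<close>,
  \<open>u^z = S\<close>, in Cartesian components. Factoring out \<open>r\<close> avoids the frame,
  which is singular on the axis.\<close>

definition flow :: "(real^3 \<Rightarrow> real) \<Rightarrow> (real^3 \<Rightarrow> real) \<Rightarrow> (real^3 \<Rightarrow> real) \<Rightarrow> real^3 \<Rightarrow> real^3" where
  "flow R g S x = vector [- (x $ 1 * R x) - x $ 2 * g x, - (x $ 2 * R x) + x $ 1 * g x, S x]"

lemma flow_nth [simp]:
  "flow R g S x $ 1 = - (x $ 1 * R x) - x $ 2 * g x"
  "flow R g S x $ 2 = - (x $ 2 * R x) + x $ 1 * g x"
  "flow R g S x $ 3 = S x"
  by (simp_all add: flow_def)

lemma partial_eqI: "(f has_derivative D) (at x) \<Longrightarrow> partial i f x = D (axis i 1)"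
  unfolding partial_def using frechet_derivative_at by metis

lemma has_derivative_nth: "((\<lambda>x. x $ i) has_derivative (\<lambda>v. v $ i)) (at x)"
  by (rule bounded_linear_imp_has_derivative) (rule bounded_linear_vec_nth)

lemma axis3_nth [simp]:
  "axis i (1::real) $ j = (if j = i then 1 else 0)"
  by (simp add: axis_def)

lemma partial_axi_deriv:
  assumes "axi_deriv f q z x"
  shows "partial 1 f x = x $ 1 * q" "partial 2 f x = x $ 2 * q" "partial 3 f x = z"
  using partial_eqI[OF assms[unfolded axi_deriv_def]] by simp_all

lemma has_derivative_flow:
  assumes "axi_deriv R Rq Rz x" "axi_deriv g gq gz x" "axi_deriv S Sq Sz x"
  defines "D \<equiv> \<lambda>q z v. (x $ 1 * v $ 1 + x $ 2 * v $ 2) * q + v $ 3 * z"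
  shows
    "((\<lambda>y. flow R g S y $ 1) has_derivative
       (\<lambda>v. - (x $ 1 * D Rq Rz v + v $ 1 * R x) - (x $ 2 * D gq gz v + v $ 2 * g x))) (at x)"
    "((\<lambda>y. flow R g S y $ 2) has_derivative
       (\<lambda>v. - (x $ 2 * D Rq Rz v + v $ 2 * R x) + (x $ 1 * D gq gz v + v $ 1 * g x))) (at x)"
    "((\<lambda>y. flow R g S y $ 3) has_derivative D Sq Sz) (at x)"
proof -
  note d = assms(1-3)[unfolded axi_deriv_def, THEN has_derivative_mult[OF has_derivative_nth]]
  show "((\<lambda>y. flow R g S y $ 1) has_derivative
       (\<lambda>v. - (x $ 1 * D Rq Rz v + v $ 1 * R x) - (x $ 2 * D gq gz v + v $ 2 * g x))) (at x)"
    unfolding flow_nth D_def by (rule has_derivative_diff[OF has_derivative_minus[OF d(1)] d(2)])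
  show "((\<lambda>y. flow R g S y $ 2) has_derivative
       (\<lambda>v. - (x $ 2 * D Rq Rz v + v $ 2 * R x) + (x $ 1 * D gq gz v + v $ 1 * g x))) (at x)"
    unfolding flow_nth D_def by (rule has_derivative_add[OF has_derivative_minus[OF d(1)] d(2)])
  show "((\<lambda>y. flow R g S y $ 3) has_derivative D Sq Sz) (at x)"
    unfolding flow_nth D_def using assms(3) by (simp add: axi_deriv_def)
qed

context
  fixes R g S :: "real^3 \<Rightarrow> real" and x :: "real^3" and Rq Rz gq gz Sq Sz :: real
  assumes R: "axi_deriv R Rq Rz x" and g: "axi_deriv g gq gz x" and S: "axi_deriv S Sq Sz x"
begin

lemma partial_flow:
  "partial 1 (\<lambda>y. flow R g S y $ 1) x = - (x $ 1 * (x $ 1 * Rq) + R x) - x $ 2 * (x $ 1 * gq)"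
  "partial 2 (\<lambda>y. flow R g S y $ 1) x = - (x $ 1 * (x $ 2 * Rq)) - (x $ 2 * (x $ 2 * gq) + g x)"
  "partial 3 (\<lambda>y. flow R g S y $ 1) x = - (x $ 1 * Rz) - x $ 2 * gz"
  "partial 1 (\<lambda>y. flow R g S y $ 2) x = - (x $ 2 * (x $ 1 * Rq)) + (x $ 1 * (x $ 1 * gq) + g x)"
  "partial 2 (\<lambda>y. flow R g S y $ 2) x = - (x $ 2 * (x $ 2 * Rq) + R x) + x $ 1 * (x $ 2 * gq)"
  "partial 3 (\<lambda>y. flow R g S y $ 2) x = - (x $ 2 * Rz) + x $ 1 * gz"
  "partial 1 (\<lambda>y. flow R g S y $ 3) x = x $ 1 * Sq"
  "partial 2 (\<lambda>y. flow R g S y $ 3) x = x $ 2 * Sq"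
  "partial 3 (\<lambda>y. flow R g S y $ 3) x = Sz"
  unfolding has_derivative_flow[OF R g S, THEN partial_eqI] by simp_all

lemma differentiable_flow: "flow R g S differentiable (at x)"
proof -
  have "(\<lambda>y. flow R g S y $ i) differentiable (at x)" for i
    using exhaust_3[of i] has_derivative_flow[OF R g S, THEN differentiableI] by (elim disjE) (simp_all only:)
  then show ?thesis
    by (subst differentiable_componentwise_within) (auto simp: Basis_vec_def inner_axis)
qed

lemma divergence_flow:
  "divergence (flow R g S) x = - 2 * R x - ((x $ 1)\<^sup>2 + (x $ 2)\<^sup>2) * Rq + Sz"
  unfolding divergence_def sum_3 partial_flow by (simp add: algebra_simps power2_eq_square)

lemma convective_flow:
  defines "D \<equiv> \<lambda>q z. - (((x $ 1)\<^sup>2 + (x $ 2)\<^sup>2) * R x * q) + S x * z"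
  shows
    "convective (flow R g S) x = vector
      [x $ 1 * ((R x)\<^sup>2 - (g x)\<^sup>2 - D Rq Rz) + x $ 2 * (2 * g x * R x - D gq gz),
       x $ 2 * ((R x)\<^sup>2 - (g x)\<^sup>2 - D Rq Rz) - x $ 1 * (2 * g x * R x - D gq gz),
       D Sq Sz]"
  unfolding vec_eq_iff forall_3 convective_def sum_3 vec_lambda_beta partial_flow vector_3 D_def
  by (simp add: algebra_simps power2_eq_square)

lemma curl_flow:
  "curl (flow R g S) x = vector
    [x $ 2 * (Sq + Rz) - x $ 1 * gz, - (x $ 1 * (Sq + Rz)) - x $ 2 * gz,
     2 * g x + ((x $ 1)\<^sup>2 + (x $ 2)\<^sup>2) * gq]"
  unfolding vec_eq_iff forall_3 curl_def partial_flow vector_3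
  by (simp add: algebra_simps power2_eq_square)

end

lemma grad_axi_deriv:
  assumes "axi_deriv p pq pz x"
  shows "grad p x = vector [x $ 1 * pq, x $ 2 * pq, pz]"
  unfolding vec_eq_iff forall_3 grad_def vec_lambda_beta vector_3 partial_axi_deriv[OF assms] by simp

section \<open>Homogeneous axisymmetric functions\<close>

lemma norm_eq_3: "norm x = sqrt ((x $ 1)\<^sup>2 + (x $ 2)\<^sup>2 + (x $ 3)\<^sup>2)" for x :: "real^3"
  by (simp add: norm_vec_def L2_set_def sum_3)

lemma inner_eq_3: "x \<bullet> y = x $ 1 * y $ 1 + x $ 2 * y $ 2 + x $ 3 * y $ 3" for x y :: "real^3"
  by (simp add: inner_vec_def sum_3)

text \<open>The general (-a)-homogeneous axisymmetric function, with profile \<open>h\<close> in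
  \<open>cos \<theta>\<close>.\<close>

definition hom :: "real \<Rightarrow> (real \<Rightarrow> real) \<Rightarrow> real^3 \<Rightarrow> real" where
  "hom a h x = norm x powr (- a) * h (x $ 3 / norm x)"

lemma hom_scale:
  assumes "0 < l"
  shows "l powr a * hom a h (l *\<^sub>R x) = hom a h x"
  using assms by (simp add: hom_def powr_mult powr_minus field_simps)

lemma axi_deriv_hom:
  assumes x: "x \<noteq> 0" and h: "(h has_real_derivative d) (at (x $ 3 / norm x))"
  defines "t \<equiv> x $ 3 / norm x"
  shows "axi_deriv (hom a h)
    (- (norm x powr (- a) / (norm x)\<^sup>2 * (a * h t + t * d)))
    (norm x powr (- a) / norm x * ((1 - t\<^sup>2) * d - a * t * h t)) x"
proof -
  let ?n = "norm x"
  have n: "0 < ?n" using x by simp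
  have dn: "(norm has_derivative (\<lambda>v. (x \<bullet> v) / ?n)) (at x)"
    using has_derivative_norm[OF x] by (simp add: sgn_div_norm divide_inverse mult.commute inner_commute)
  have "((\<lambda>y. norm y powr (- a)) has_derivative (\<lambda>v. - a * ?n powr (- a - 1) * ((x \<bullet> v) / ?n))) (at x)"
  proof -
    have "((\<lambda>r. r powr (- a)) has_real_derivative - a * ?n powr (- a - 1)) (at ?n)"
      using n by (auto intro!: derivative_eq_intros)
    from has_derivative_compose[OF dn this[unfolded has_field_derivative_def]] show ?thesis by simp
  qed
  moreover have "((\<lambda>y. h (y $ 3 / norm y)) has_derivative
      (\<lambda>v. d * ((v $ 3 * ?n - x $ 3 * ((x \<bullet> v) / ?n)) / (?n * ?n)))) (at x)"
  proof -
    have "((\<lambda>y. y $ 3 / norm y) has_derivative (\<lambda>v. (v $ 3 * ?n - x $ 3 * ((x \<bullet> v) / ?n)) / (?n * ?n))) (at x)"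
      by (rule has_derivative_divide'[OF has_derivative_nth dn]) (use n in simp)
    from has_derivative_compose[OF this h[unfolded has_field_derivative_def]] show ?thesis by simp
  qed
  ultimately have "(hom a h has_derivative
      (\<lambda>v. ?n powr (- a) * (d * ((v $ 3 * ?n - x $ 3 * ((x \<bullet> v) / ?n)) / (?n * ?n)))
        + - a * ?n powr (- a - 1) * ((x \<bullet> v) / ?n) * h t)) (at x)"
    unfolding hom_def t_def by (rule has_derivative_mult)
  moreover have "?n powr (- a) * (d * ((v $ 3 * ?n - x $ 3 * ((x \<bullet> v) / ?n)) / (?n * ?n)))
        + - a * ?n powr (- a - 1) * ((x \<bullet> v) / ?n) * h t
      = (x $ 1 * v $ 1 + x $ 2 * v $ 2) * (- (?n powr (- a) / ?n\<^sup>2 * (a * h t + t * d)))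
        + v $ 3 * (?n powr (- a) / ?n * ((1 - t\<^sup>2) * d - a * t * h t))" for v
  proof -
    have p: "?n powr (- a - 1) = ?n powr (- a) / ?n" using n by (simp add: powr_diff)
    have x3: "x $ 3 = t * ?n" using n by (simp add: t_def)
    show ?thesis unfolding p inner_eq_3 x3 using n
      by (simp add: field_simps power2_eq_square)
  qed
  ultimately show ?thesis by (simp add: axi_deriv_def)
qed

lemma open_punctured_space: "open (punctured_space :: (real^3) set)"
  by (rule open_Compl) simp

lemma C_k_norm_powr: "C_k k punctured_space (\<lambda>x. norm x powr a)"
proof -
  \<comment> \<open>As a power of \<open>x \<bullet> x\<close> the function is covered by the rules
    for bilinear maps and composition.\<close>
  have "C_k k punctured_space (\<lambda>x::real^3. (x \<bullet> x) powr (a / 2))"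
    by (rule C_k_compose[OF _ _ _ C_k_powr C_k_bilinear[OF _ bounded_bilinear_inner
          C_k_bounded_linear C_k_bounded_linear]]) (auto intro: bounded_linear_ident)
  moreover have "(x \<bullet> x) powr (a / 2) = norm x powr a" for x :: "real^3"
    by (simp add: powr_powr flip: power2_norm_eq_inner powr_numeral)
  ultimately show ?thesis by simp
qed

lemma C_k_nth: "C_k k S (\<lambda>x. x $ i)" for S :: "(real^3) set"
  by (rule C_k_bounded_linear) (rule bounded_linear_vec_nth)

lemma C_k_hom:
  assumes "C_k k UNIV h"
  shows "C_k k punctured_space (hom a h)"
proof -
  note op = open_punctured_space
  have "C_k k punctured_space (\<lambda>x. x $ 3 * norm x powr -1)"
    by (rule C_k_mult[OF op C_k_nth C_k_norm_powr])
  from C_k_compose[OF op open_UNIV subset_UNIV assms this]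
  have "C_k k punctured_space (\<lambda>x. h (x $ 3 * norm x powr -1))" .
  from C_k_mult[OF op C_k_norm_powr this]
  have "C_k k punctured_space (\<lambda>x. norm x powr (- a) * h (x $ 3 * norm x powr -1))" .
  then show ?thesis unfolding hom_def by (simp add: powr_minus divide_inverse)
qed

section \<open>Topology of the level sets\<close>

lemma level_set_empty:
  assumes "C \<le> 0" "\<And>t. - 1 < t \<Longrightarrow> t < 1 \<Longrightarrow> 0 < w t"
    and \<psi>: "\<And>z r. 0 < r \<Longrightarrow> \<psi> (z, r) = norm (z, r) powr (- \<beta>) * w (z / norm (z, r))"
  shows "level_set \<psi> C = {}"
proof -
  have "0 < \<psi> (z, r)" if r: "0 < r" for z r
  proof -
    have "\<bar>z\<bar> < norm (z, r)" using r by (auto simp: norm_Pair intro!: real_less_rsqrt)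
    moreover have "0 < norm (z, r)" using r by (simp add: zero_prod_def)
    ultimately have "\<bar>z / norm (z, r)\<bar> < 1" by (simp only: abs_divide abs_norm_cancel divide_less_eq_1_pos)
    then have "0 < w (z / norm (z, r))" by (intro assms(2)) linarith+
    then show ?thesis using r by (simp add: \<psi> zero_prod_def)
  qed
  then have "\<psi> (z, r) \<noteq> C" if "0 < r" for z r using assms(1) that by (metis not_less)
  then show ?thesis by (auto simp: level_set_def)
qed

text \<open>In polar coordinates the level set is the graph \<open>\<rho> = (w(cos \<theta>) / C)\<^bsup>1/\<beta>\<^esup>\<close>.\<close>

lemma level_set_homeomorphic_interval:
  assumes \<beta>: "0 < \<beta>" and C: "0 < C"
    and w_pos: "\<And>t. - 1 < t \<Longrightarrow> t < 1 \<Longrightarrow> 0 < w t" and w: "continuous_on {-1<..<1} w"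
    and \<psi>: "\<And>z r. 0 < r \<Longrightarrow> \<psi> (z, r) = norm (z, r) powr (- \<beta>) * w (z / norm (z, r))"
  shows "level_set \<psi> C homeomorphic {-1<..<1::real}"
proof -
  define \<rho> where "\<rho> t = (w t / C) powr (1 / \<beta>)" for t
  define f where "f t = (\<rho> t * t, \<rho> t * sqrt (1 - t\<^sup>2))" for t
  define g where "g y = fst y / norm y" for y :: "real \<times> real"
  have sq: "0 < 1 - t\<^sup>2" if "t \<in> {-1<..<1}" for t :: real
    using that by (simp add: abs_square_less_1 abs_less_iff)
  have \<rho>: "0 < \<rho> t" "\<rho> t powr (- \<beta>) = C / w t" if "t \<in> {-1<..<1}" for t
    using w_pos[of t] that C \<beta> by (auto simp: \<rho>_def powr_powr powr_minus)
  have normf: "norm (f t) = \<rho> t" if "t \<in> {-1<..<1}" for t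
  proof -
    have "(\<rho> t * t)\<^sup>2 + (\<rho> t * sqrt (1 - t\<^sup>2))\<^sup>2 = (\<rho> t)\<^sup>2"
      using sq[OF that] by (simp add: power_mult_distrib algebra_simps)
    then show ?thesis using \<rho>(1)[OF that] by (simp add: f_def norm_Pair)
  qed
  have g_range: "g y \<in> {-1<..<1}" "norm y * g y = fst y" "norm y * sqrt (1 - (g y)\<^sup>2) = snd y" "0 < norm y"
    if "0 < snd y" for y
  proof -
    obtain z r where y: "y = (z, r)" by force
    have r: "0 < r" using that y by simp
    then have n: "0 < norm y" by (simp add: y zero_prod_def)
    have n2: "(norm y)\<^sup>2 = z\<^sup>2 + r\<^sup>2" by (simp add: y norm_Pair)
    have "\<bar>z\<bar> < norm y" unfolding y using r by (auto simp: norm_Pair intro!: real_less_rsqrt)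
    then have "\<bar>g y\<bar> < 1" using n by (simp add: g_def y abs_divide)
    then show "g y \<in> {-1<..<1}" by (auto simp: abs_less_iff)
    show "norm y * g y = fst y" "0 < norm y" using n by (simp_all add: g_def)
    have "1 - (g y)\<^sup>2 = ((norm y)\<^sup>2 - z\<^sup>2) / (norm y)\<^sup>2"
      using n by (simp add: g_def y power_divide diff_divide_distrib)
    then have "1 - (g y)\<^sup>2 = r\<^sup>2 / (norm y)\<^sup>2" using n2 by simp
    then have "sqrt (1 - (g y)\<^sup>2) = r / norm y" using n r by (simp add: real_sqrt_divide)
    then show "norm y * sqrt (1 - (g y)\<^sup>2) = snd y" using n by (simp add: y)
  qed
  have gf: "g (f t) = t" if "t \<in> {-1<..<1}" for t
    using normf[OF that] \<rho>(1)[OF that] by (simp add: g_def f_def)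
  have f_in: "f t \<in> level_set \<psi> C" if t: "t \<in> {-1<..<1}" for t
  proof -
    have "0 < \<rho> t * sqrt (1 - t\<^sup>2)" using \<rho>(1)[OF t] sq[OF t] by simp
    moreover have "\<psi> (f t) = norm (f t) powr (- \<beta>) * w (g (f t))"
      using calculation by (simp add: f_def \<psi> g_def)
    ultimately show ?thesis
      using normf[OF t] gf[OF t] \<rho>(2)[OF t] w_pos[of t] t by (simp add: level_set_def f_def)
  qed
  have fg: "f (g y) = y" if "y \<in> level_set \<psi> C" for y
  proof -
    have y: "0 < snd y" "\<psi> y = C" using that by (auto simp: level_set_def)
    note g = g_range[OF y(1)]
    have "C = norm y powr (- \<beta>) * w (g y)"
      using \<psi>[of "snd y" "fst y"] y by (simp add: g_def)
    then have "w (g y) = C * norm y powr \<beta>"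
      using g(4) by (simp add: powr_minus field_simps)
    then have "w (g y) / C = norm y powr \<beta>" using C by simp
    then have "\<rho> (g y) = norm y" using g(4) \<beta> by (simp add: \<rho>_def powr_powr)
    then show ?thesis using g by (simp add: f_def prod_eq_iff)
  qed
  have "homeomorphism (level_set \<psi> C) {-1<..<1} g f"
  proof (rule homeomorphismI)
    show "continuous_on (level_set \<psi> C) g" unfolding g_def
      by (intro continuous_intros) (auto simp: level_set_def zero_prod_def)
    have "w t / C \<noteq> 0" if "t \<in> {-1<..<1}" for t using w_pos[of t] that C by auto
    then show "continuous_on {-1<..<1} f" unfolding f_def \<rho>_def
      using C by (intro continuous_intros w) auto
    show "g ` level_set \<psi> C \<subseteq> {-1<..<1}" using g_range(1) by (auto simp: level_set_def)
    show "f ` {-1<..<1} \<subseteq> level_set \<psi> C" using f_in by blast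
  qed (use gf fg in auto)
  then show ?thesis by (auto simp: homeomorphic_def)
qed

lemma psi0_eq:
  assumes "0 < r"
  shows "psi0 (z, r) = norm (z, r) powr (- 1) * ((1 - (z / norm (z, r))\<^sup>2) / 2)"
proof -
  let ?n = "norm (z, r)"
  have n: "0 < ?n" using assms by (simp add: zero_prod_def)
  have "\<bar>z\<bar> \<le> ?n" by (simp add: norm_Pair real_le_rsqrt)
  then have "\<bar>z / ?n\<bar> \<le> 1" using n by (simp add: abs_divide)
  then have "cos (arccos (z / ?n)) = z / ?n" by (rule cos_arccos_abs)
  then have "(sin (arccos (z / ?n)))\<^sup>2 = 1 - (z / ?n)\<^sup>2" by (simp only: sin_squared_eq)
  then show ?thesis using n
    by (simp add: psi0_def polar_theta_def polar_rho_def norm_Pair powr_minus field_simps)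
qed

text \<open>The dipole is itself of this form, with exponent 1 and profile
  \<open>(1 - t^2) / 2\<close>. So the two level sets are both empty or both homeomorphic to an open
  interval.\<close>

lemma level_set_homeomorphic_psi0:
  assumes \<beta>: "0 < \<beta>"
    and w_pos: "\<And>t. - 1 < t \<Longrightarrow> t < 1 \<Longrightarrow> 0 < w t" and w: "continuous_on {-1<..<1} w"
    and \<psi>: "\<And>z r. 0 < r \<Longrightarrow> \<psi> (z, r) = norm (z, r) powr (- \<beta>) * w (z / norm (z, r))"
  shows "level_set \<psi> C homeomorphic level_set psi0 C"
proof -
  have w0: "0 < (1 - t\<^sup>2) / 2" if "- 1 < t" "t < 1" for t :: real
    using that by (simp add: abs_square_less_1 abs_less_iff)
  show ?thesis
  proof (cases "C \<le> 0")
    case True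
    then show ?thesis using level_set_empty[OF True w_pos \<psi>] level_set_empty[OF True w0 psi0_eq]
      by (simp add: homeomorphic_empty)
  next
    case False
    then have C: "0 < C" by simp
    have "continuous_on {-1<..<1} (\<lambda>t::real. (1 - t\<^sup>2) / 2)" by (intro continuous_intros) auto
    from level_set_homeomorphic_interval[OF zero_less_one C w0 this psi0_eq]
      level_set_homeomorphic_interval[OF \<beta> C w_pos w \<psi>]
    show ?thesis using homeomorphic_sym homeomorphic_trans by blast
  qed
qed

section \<open>The cylindrical frame and the meridian half plane\<close>

lemma cyl_r_sq: "(cyl_r x)\<^sup>2 = (x $ 1)\<^sup>2 + (x $ 2)\<^sup>2"
  by (simp add: cyl_r_def)

lemma cyl_r_eq_0: "cyl_r x = 0 \<longleftrightarrow> x $ 1 = 0 \<and> x $ 2 = 0"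
  by (simp add: cyl_r_def)

lemma frame_nth [simp]:
  "e_r x $ 1 = x $ 1 / cyl_r x" "e_r x $ 2 = x $ 2 / cyl_r x" "e_r x $ 3 = 0"
  "e_phi x $ 1 = - (x $ 2) / cyl_r x" "e_phi x $ 2 = x $ 1 / cyl_r x" "e_phi x $ 3 = 0"
  "e_z $ 1 = 0" "e_z $ 2 = 0" "e_z $ 3 = 1"
  by (simp_all add: e_r_def e_phi_def e_z_def)

lemma cyl_r_frame: "cyl_r x * (x $ i / cyl_r x) = x $ i" if "i = 1 \<or> i = 2"
  using that cyl_r_eq_0[of x] by auto

lemma flow_inner_frame:
  "flow R g S x \<bullet> e_r x = - (cyl_r x * R x)"
  "flow R g S x \<bullet> e_phi x = cyl_r x * g x"
  "flow R g S x \<bullet> e_z = S x"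
proof -
  have r: "x $ 1 * (x $ 1 / cyl_r x) + x $ 2 * (x $ 2 / cyl_r x) = cyl_r x"
    using cyl_r_sq[of x] by (cases "cyl_r x = 0") (auto simp: cyl_r_eq_0 field_simps power2_eq_square)
  have "flow R g S x \<bullet> e_r x = - (R x * (x $ 1 * (x $ 1 / cyl_r x) + x $ 2 * (x $ 2 / cyl_r x)))"
    by (simp add: inner_eq_3 algebra_simps)
  then show "flow R g S x \<bullet> e_r x = - (cyl_r x * R x)" by (simp only: r mult.commute)
  have "flow R g S x \<bullet> e_phi x = g x * (x $ 1 * (x $ 1 / cyl_r x) + x $ 2 * (x $ 2 / cyl_r x))"
    by (simp add: inner_eq_3 algebra_simps)
  then show "flow R g S x \<bullet> e_phi x = cyl_r x * g x" by (simp only: r mult.commute)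
qed (simp add: inner_eq_3)

lemma flow_frame:
  "flow R g S x = (- (cyl_r x * R x)) *\<^sub>R e_r x + (cyl_r x * g x) *\<^sub>R e_phi x + S x *\<^sub>R e_z"
proof -
  have e: "(cyl_r x * c) * (x $ 1 / cyl_r x) = x $ 1 * c" "(cyl_r x * c) * (x $ 2 / cyl_r x) = x $ 2 * c" for c
    using cyl_r_frame[of 1 x] cyl_r_frame[of 2 x] by (metis mult.assoc mult.commute)+
  show ?thesis
    unfolding vec_eq_iff forall_3 using e[of "R x"] e[of "g x"] by simp
qed

lemma poloidal_flow: "poloidal (flow R g S) = flow R (\<lambda>_. 0) S"
  by (rule ext) (simp add: poloidal_def flow_inner_frame flow_frame[of R "\<lambda>_. 0"])

lemma swirl_flow: "swirl (flow R g S) = flow (\<lambda>_. 0) g (\<lambda>_. 0)"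
  by (rule ext) (simp add: swirl_def flow_inner_frame flow_frame[of "\<lambda>_. 0"])

lemma norm_flow_sq:
  "(norm (flow R g S x))\<^sup>2 = ((x $ 1)\<^sup>2 + (x $ 2)\<^sup>2) * ((R x)\<^sup>2 + (g x)\<^sup>2) + (S x)\<^sup>2"
  unfolding power2_norm_eq_inner inner_eq_3 flow_nth by (simp add: algebra_simps power2_eq_square)

lemma C_k_flow:
  assumes "C_k k punctured_space R" "C_k k punctured_space g" "C_k k punctured_space S"
  shows "C_k k punctured_space (flow R g S)"
proof (rule C_k_vec[OF open_punctured_space])
  fix i :: 3
  note op = open_punctured_space
  have "C_k k punctured_space (\<lambda>x. flow R g S x $ 1)" "C_k k punctured_space (\<lambda>x. flow R g S x $ 2)"
    "C_k k punctured_space (\<lambda>x. flow R g S x $ 3)"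
    unfolding flow_nth
    by (intro C_k_diff[OF op] C_k_add[OF op] C_k_minus[OF op] C_k_mult[OF op C_k_nth] assms)+
  then show "C_k k punctured_space (\<lambda>x. flow R g S x $ i)"
    using exhaust_3[of i] by (elim disjE) (simp_all only:)
qed

text \<open>The half plane is embedded in space as \<open>(z, r) \<mapsto> (r, 0, z)\<close>, which
  lets functions of \<open>(z, r)\<close> inherit the calculus of \<open>hom\<close>.\<close>

lemma linear_meridian: "linear (\<lambda>y::real \<times> real. vector [snd y, 0, fst y] :: real^3)"
  by (rule linearI) (simp_all add: vec_eq_iff forall_3)

lemma norm_meridian: "norm (vector [r, 0, z] :: real^3) = norm (z, r)"
  by (simp add: norm_eq_3 norm_Pair add.commute)

lemma hom_meridian: "hom a h x = hom a h (vector [cyl_r x, 0, x $ 3])"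
proof -
  have "norm (vector [cyl_r x, 0, x $ 3] :: real^3) = norm x"
    by (simp add: norm_eq_3 cyl_r_sq)
  then show ?thesis by (simp add: hom_def)
qed

text \<open>
  The momentum equation on the profile level. Here \<open>H\<close> is the derivative of
  \<open>w\<^bsup>1/\<beta>\<^esup>\<close> with respect to \<open>w\<close>, so \<open>\<beta> w H = w\<^bsup>1/\<beta>\<^esup>\<close>, and \<open>Y = w\<^bsup>1+4/\<beta>\<^esup>\<close>.
\<close>

lemma profile_identities:
  fixes \<beta> t V V1 H Y \<gamma> B :: real
  defines "w \<equiv> (1 - t\<^sup>2) * V" and "w1 \<equiv> - 2 * t * V + (1 - t\<^sup>2) * V1"
  defines "G \<equiv> \<beta> * (w * H)"
  defines "w2 \<equiv> - (\<beta> * (\<beta> + 1) * V + \<gamma>\<^sup>2 * (V * (G\<^sup>2 + w * G * H)) + B * Y)"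
  defines "R \<equiv> w1 - \<beta> * t * V" and "R1 \<equiv> w2 - \<beta> * V - \<beta> * t * V1"
  defines "S \<equiv> - t * w1 - \<beta> * w" and "S1 \<equiv> - w1 - t * w2 - \<beta> * w1"
  defines "k \<equiv> \<gamma> * V * G" and "k1 \<equiv> \<gamma> * (V1 * G + V * (H * w1))"
  defines "P \<equiv> - \<beta> * B * w * Y - (\<beta> + 2) * (w1\<^sup>2 + \<beta>\<^sup>2 * w * V) - (\<beta> + 2) * \<gamma>\<^sup>2 * (V * (w * G\<^sup>2))"
  defines "P1 \<equiv> - B * Y * w1 - (2 * w1 * w2 + \<beta>\<^sup>2 * (w1 * V + w * V1)) / 2
     - \<gamma>\<^sup>2 / 2 * (V1 * (w * G\<^sup>2) + V * (w1 * G\<^sup>2 + 2 * w * G * H * w1))"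
  shows
    "R\<^sup>2 - k\<^sup>2 - ((1 - t\<^sup>2) * R * ((\<beta> + 3) * R + t * R1) + S * ((1 - t\<^sup>2) * R1 - (\<beta> + 3) * t * R)) - (P + t * P1) = 0" (is ?A)
    "2 * k * R - ((1 - t\<^sup>2) * R * ((\<beta> + 3) * k + t * k1) + S * ((1 - t\<^sup>2) * k1 - (\<beta> + 3) * t * k)) = 0" (is ?B)
    "(1 - t\<^sup>2) * R * ((\<beta> + 2) * S + t * S1) + S * ((1 - t\<^sup>2) * S1 - (\<beta> + 2) * t * S) + ((1 - t\<^sup>2) * P1 - t * P) = 0" (is ?C)
    "- 2 * R + (1 - t\<^sup>2) * ((\<beta> + 3) * R + t * R1) + ((1 - t\<^sup>2) * S1 - (\<beta> + 2) * t * S) = 0" (is ?D)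
    "- ((\<beta> + 2) * S + t * S1) + ((1 - t\<^sup>2) * R1 - (\<beta> + 3) * t * R) = w2 + \<beta> * (\<beta> + 1) * V" (is ?E)
    "(1 - t\<^sup>2) * k1 - (\<beta> + 3) * t * k = \<gamma> * (G + w * H) * R" (is ?F)
    "2 * k - (1 - t\<^sup>2) * ((\<beta> + 3) * k + t * k1) = \<gamma> * (G + w * H) * S" (is ?G)
proof -
  have tr: "(1 - t\<^sup>2) * R - t * S = w1" "t * R + S = - (\<beta> * V)"
    unfolding R_def S_def w_def by (simp_all add: algebra_simps power2_eq_square)
  \<comment> \<open>The derivative along the flow of a function with profile \<open>h\<close> and
    degree \<open>-a\<close> is, up to powers of \<open>|x|\<close>, its Jacobian with the stream
    function. It vanishes for \<open>h\<close> a multiple of \<open>w^(a/\<beta>)\<close>, that is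
    for functions of the stream function.\<close>
  have D: "(1 - t\<^sup>2) * R * (a * h + t * d) + S * ((1 - t\<^sup>2) * d - a * t * h) = a * h * w1 - \<beta> * w * d" for a h d
  proof -
    have "(1 - t\<^sup>2) * R * (a * h + t * d) + S * ((1 - t\<^sup>2) * d - a * t * h)
        = a * h * ((1 - t\<^sup>2) * R - t * S) + (1 - t\<^sup>2) * d * (t * R + S)"
      by (simp add: algebra_simps)
    then show ?thesis unfolding tr by (simp add: w_def algebra_simps)
  qed
  show ?A unfolding D
    unfolding R_def R1_def k_def P_def P1_def w2_def G_def w1_def w_def
    by (simp add: field_simps power2_eq_square)
  show ?B unfolding D
    unfolding R_def k_def k1_def G_def w1_def w_def by (simp add: algebra_simps power2_eq_square)
  show ?C unfolding D
    unfolding S_def S1_def P_def P1_def w2_def G_def w1_def w_def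
    by (simp add: field_simps power2_eq_square)
  show ?D ?E
    unfolding R_def R1_def S_def S1_def w1_def w_def by (simp_all add: algebra_simps power2_eq_square)
  show ?F unfolding k_def k1_def G_def R_def w1_def w_def by (simp add: algebra_simps power2_eq_square)
  show ?G unfolding k_def k1_def G_def S_def w1_def w_def by (simp add: algebra_simps power2_eq_square)
qed

section \<open>The solutions of the Euler equations\<close>

text \<open>Removes the powers of \<open>\<rho>\<close> from the four equations for the components of the flow.\<close>

lemma scaled_identities:
  fixes e n t :: real
  assumes n: "n \<noteq> 0"
  shows
    "(e / n ^ 3 * R)\<^sup>2 - (e / n ^ 3 * k)\<^sup>2
      - (- ((n\<^sup>2 * (1 - t\<^sup>2)) * (e / n ^ 3 * R) * (- (e / n ^ 3 / n\<^sup>2 * Qa))) + (e / n\<^sup>2 * S) * (e / n ^ 3 / n * Za))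
      + (- (e\<^sup>2 / n ^ 4 / n\<^sup>2 * Pa))
     = e\<^sup>2 / n ^ 6 * (R\<^sup>2 - k\<^sup>2 - ((1 - t\<^sup>2) * R * Qa + S * Za) - Pa)"
    "2 * (e / n ^ 3 * k) * (e / n ^ 3 * R)
      - (- ((n\<^sup>2 * (1 - t\<^sup>2)) * (e / n ^ 3 * R) * (- (e / n ^ 3 / n\<^sup>2 * Qb))) + (e / n\<^sup>2 * S) * (e / n ^ 3 / n * Zb))
     = e\<^sup>2 / n ^ 6 * (2 * k * R - ((1 - t\<^sup>2) * R * Qb + S * Zb))"
    "- ((n\<^sup>2 * (1 - t\<^sup>2)) * (e / n ^ 3 * R) * (- (e / n\<^sup>2 / n\<^sup>2 * Qc))) + (e / n\<^sup>2 * S) * (e / n\<^sup>2 / n * Zc)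
      + e\<^sup>2 / n ^ 4 / n * Pb
     = e\<^sup>2 / n ^ 5 * ((1 - t\<^sup>2) * R * Qc + S * Zc + Pb)"
    "- 2 * (e / n ^ 3 * R) - (n\<^sup>2 * (1 - t\<^sup>2)) * (- (e / n ^ 3 / n\<^sup>2 * Qa)) + e / n\<^sup>2 / n * Zc
     = e / n ^ 3 * (- 2 * R + (1 - t\<^sup>2) * Qa + Zc)"
  using n by (simp_all add: field_simps power2_eq_square power3_eq_cube eval_nat_numeral)

section \<open>Profiles of velocity and pressure\<close>

context euler_profile
begin

definition w :: "real \<Rightarrow> real" where "w t = (1 - t\<^sup>2) * V t"

text \<open>The circulation \<open>F = r u^\<phi> = \<gamma> \<psi>^(1 + 1/\<beta>)\<close> enters
  the Grad-Shafranov equation through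
  \<open>F F' = \<gamma>^2 (1 + 1/\<beta>) \<psi>^(1 + 2/\<beta>)\<close>, whose coefficient has to
  be \<open>A\<close>.\<close>

definition \<gamma> :: real where "\<gamma> = sqrt (A * \<beta> / (\<beta> + 1))"

definition G :: "real \<Rightarrow> real" where "G t = ppow (1 / \<beta>) (w t)"
definition K :: "real \<Rightarrow> real" where "K t = ppow (1 / \<beta> - 1) (w t) / \<beta>"
definition Y :: "real \<Rightarrow> real" where "Y t = ppow (1 + 4 / \<beta>) (w t)"

definition w'' :: "real \<Rightarrow> real" where
  "w'' t = - (\<beta> * (\<beta> + 1) * V t + A * V t * ppow (2 / \<beta>) (w t) + B * ppow (1 + 4 / \<beta>) (w t))"

text \<open>\<open>R\<close>, \<open>S\<close> and \<open>k\<close> are the profiles of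
  \<open>\<partial>_z \<psi> / r^2\<close>, \<open>\<partial>_r \<psi> / r\<close> and
  \<open>u^\<phi> / r\<close>. The division by \<open>r^2\<close> is exact because \<open>w\<close>
  contains the factor \<open>1 - t^2\<close>.\<close>

definition R :: "real \<Rightarrow> real" where "R t = w' t - \<beta> * t * V t"
definition R' :: "real \<Rightarrow> real" where "R' t = w'' t - \<beta> * V t - \<beta> * t * V' t"
definition S :: "real \<Rightarrow> real" where "S t = - t * w' t - \<beta> * w t"
definition S' :: "real \<Rightarrow> real" where "S' t = - w' t - t * w'' t - \<beta> * w' t"
definition k :: "real \<Rightarrow> real" where "k t = \<gamma> * V t * G t"
definition k' :: "real \<Rightarrow> real" where "k' t = \<gamma> * (V' t * G t + V t * (K t * w' t))"
text \<open>Bernoulli function minus kinetic energy. The first term integrates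
  \<open>- B \<psi>^(1 + 4/\<beta>)\<close> in the stream function; the poloidal part of
  \<open>|u|^2\<close> has the profile \<open>w'^2 + \<beta>^2 w V\<close>, the swirl part
  \<open>\<gamma>^2 V w^(1 + 2/\<beta>)\<close>.\<close>

definition P :: "real \<Rightarrow> real" where
  "P t = - B / (2 + 4 / \<beta>) * ppow (2 + 4 / \<beta>) (w t) - ((w' t)\<^sup>2 + \<beta>\<^sup>2 * w t * V t) / 2
     - \<gamma>\<^sup>2 / 2 * (V t * ppow (1 + 2 / \<beta>) (w t))"
definition P' :: "real \<Rightarrow> real" where
  "P' t = - B * Y t * w' t - (2 * w' t * w'' t + \<beta>\<^sup>2 * (w' t * V t + w t * V' t)) / 2
     - \<gamma>\<^sup>2 / 2 * (V' t * ppow (1 + 2 / \<beta>) (w t) + V t * ((1 + 2 / \<beta>) * ppow (2 / \<beta>) (w t) * w' t))"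

lemma w_deriv: "(w has_real_derivative w' t) (at t)"
  using deriv_w[of t] by (simp add: w_def[abs_def])

lemma w'_deriv: "(w' has_real_derivative w'' t) (at t)"
  using deriv_w'[of t] by (simp add: w_def w''_def)

lemma w'_eq: "w' t = - 2 * t * V t + (1 - t\<^sup>2) * V' t"
proof (rule DERIV_unique[OF deriv_w])
  show "((\<lambda>t. (1 - t\<^sup>2) * V t) has_real_derivative - 2 * t * V t + (1 - t\<^sup>2) * V' t) (at t)"
    by (auto intro!: derivative_eq_intros deriv_V)
qed

lemma w_nonneg: "\<bar>t\<bar> \<le> 1 \<Longrightarrow> 0 \<le> w t"
  using V_pos[of t] abs_square_le_1[of t] by (simp add: w_def)

lemma w_pos: "\<bar>t\<bar> < 1 \<Longrightarrow> 0 < w t"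
  using V_pos[of t] abs_square_less_1[of t] by (simp add: w_def)

lemma exponents: "1 < 1 / \<beta>" "2 < 2 / \<beta>" "4 < 4 / \<beta>"
  using \<beta> by (simp_all add: field_simps)

lemma \<gamma>_sq: "\<gamma>\<^sup>2 * (1 + 1 / \<beta>) = A"
proof -
  have "1 + 1 / \<beta> = (\<beta> + 1) / \<beta>" using \<beta> by (simp add: field_simps)
  then show ?thesis using \<beta> AB by (simp add: \<gamma>_def)
qed

lemma G_eq: "\<bar>t\<bar> \<le> 1 \<Longrightarrow> G t = \<beta> * (w t * K t)"
  using w_nonneg[of t] ppow_Suc[of "w t" "1 / \<beta> - 1"] exponents \<beta> by (simp add: G_def K_def)

lemma ppow_eq_G: "ppow (2 / \<beta>) (w t) = (G t)\<^sup>2"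
  using ppow_add[of "1 / \<beta>" "1 / \<beta>" "w t"] by (simp add: G_def power2_eq_square)

lemma A_G: "\<bar>t\<bar> \<le> 1 \<Longrightarrow> A * G t = \<gamma>\<^sup>2 * (G t + w t * K t)"
proof -
  assume t: "\<bar>t\<bar> \<le> 1"
  have G: "G t / \<beta> = w t * K t" using G_eq[OF t] \<beta> by simp
  have "A * G t = \<gamma>\<^sup>2 * (1 + 1 / \<beta>) * G t" by (simp only: \<gamma>_sq)
  also have "\<dots> = \<gamma>\<^sup>2 * (G t + G t / \<beta>)" by (simp add: algebra_simps)
  finally show ?thesis by (simp only: G)
qed

lemma w''_eq:
  assumes "\<bar>t\<bar> \<le> 1"
  shows "w'' t = - (\<beta> * (\<beta> + 1) * V t + \<gamma>\<^sup>2 * (V t * ((G t)\<^sup>2 + w t * G t * K t)) + B * Y t)"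
proof -
  have "A * V t * (G t)\<^sup>2 = V t * G t * (A * G t)" by (simp add: power2_eq_square)
  also have "\<dots> = \<gamma>\<^sup>2 * (V t * ((G t)\<^sup>2 + w t * G t * K t))"
    unfolding A_G[OF assms] by (simp add: algebra_simps power2_eq_square)
  finally show ?thesis by (simp add: w''_def ppow_eq_G Y_def)
qed

lemma deriv_ppow_w:
  assumes "1 < a"
  shows "((\<lambda>t. ppow a (w t)) has_real_derivative a * ppow (a - 1) (w t) * w' t) (at t)"
  by (rule DERIV_chain2[OF has_derivative_ppow[OF assms] w_deriv])

lemma R_deriv: "(R has_real_derivative R' t) (at t)"
  unfolding R_def[abs_def] R'_def
  by (rule derivative_eq_intros w'_deriv deriv_V refl)+ simp

lemma S_deriv: "(S has_real_derivative S' t) (at t)"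
  unfolding S_def[abs_def] S'_def
  by (rule derivative_eq_intros w'_deriv w_deriv refl)+ simp

lemma k_deriv: "(k has_real_derivative k' t) (at t)"
proof -
  have "(G has_real_derivative K t * w' t) (at t)"
    using deriv_ppow_w[OF exponents(1)] by (simp add: G_def[abs_def] K_def)
  then show ?thesis unfolding k_def[abs_def] k'_def
    by (auto intro!: derivative_eq_intros deriv_V simp: algebra_simps)
qed

lemma P_deriv: "(P has_real_derivative P' t) (at t)"
proof -
  have "((\<lambda>t. ppow (2 + 4 / \<beta>) (w t)) has_real_derivative (2 + 4 / \<beta>) * (Y t * w' t)) (at t)"
    using deriv_ppow_w[of "2 + 4 / \<beta>" t] exponents by (simp add: Y_def mult.assoc)
  from DERIV_cmult[OF this, of "- B / (2 + 4 / \<beta>)"] exponents(3)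
  have 1: "((\<lambda>t. - B / (2 + 4 / \<beta>) * ppow (2 + 4 / \<beta>) (w t)) has_real_derivative - B * Y t * w' t) (at t)"
    by (simp add: mult.assoc)
  have 2: "((\<lambda>t. ppow (1 + 2 / \<beta>) (w t)) has_real_derivative (1 + 2 / \<beta>) * ppow (2 / \<beta>) (w t) * w' t) (at t)"
    using deriv_ppow_w[of "1 + 2 / \<beta>" t] \<beta> by simp
  have 3: "((\<lambda>t. ((w' t)\<^sup>2 + \<beta>\<^sup>2 * w t * V t) / 2) has_real_derivative
      (2 * w' t * w'' t + \<beta>\<^sup>2 * (w' t * V t + w t * V' t)) / 2) (at t)"
    by (auto intro!: derivative_eq_intros w'_deriv w_deriv deriv_V simp: algebra_simps)
  show ?thesis unfolding P_def[abs_def] P'_def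
    using DERIV_diff[OF DERIV_diff[OF 1 3] DERIV_cmult[OF DERIV_mult[OF deriv_V 2], of "\<gamma>\<^sup>2 / 2"]]
    by (simp add: algebra_simps)
qed

text \<open>In order: radial, azimuthal and axial momentum, divergence, then azimuthal, radial and
  axial vorticity. The range of \<open>t\<close> guarantees \<open>w t \<ge> 0\<close>, where the
  powers of \<open>w\<close> obey the relations that \<open>profile_identities\<close> builds
  in.\<close>

lemma identities:
  assumes t: "\<bar>t\<bar> \<le> 1"
  shows
    "(R t)\<^sup>2 - (k t)\<^sup>2 - ((1 - t\<^sup>2) * R t * ((\<beta> + 3) * R t + t * R' t) + S t * ((1 - t\<^sup>2) * R' t - (\<beta> + 3) * t * R t))
      - ((2 * \<beta> + 4) * P t + t * P' t) = 0"
    "2 * k t * R t - ((1 - t\<^sup>2) * R t * ((\<beta> + 3) * k t + t * k' t) + S t * ((1 - t\<^sup>2) * k' t - (\<beta> + 3) * t * k t)) = 0"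
    "(1 - t\<^sup>2) * R t * ((\<beta> + 2) * S t + t * S' t) + S t * ((1 - t\<^sup>2) * S' t - (\<beta> + 2) * t * S t)
      + ((1 - t\<^sup>2) * P' t - (2 * \<beta> + 4) * t * P t) = 0"
    "- 2 * R t + (1 - t\<^sup>2) * ((\<beta> + 3) * R t + t * R' t) + ((1 - t\<^sup>2) * S' t - (\<beta> + 2) * t * S t) = 0"
    "- ((\<beta> + 2) * S t + t * S' t) + ((1 - t\<^sup>2) * R' t - (\<beta> + 3) * t * R t) = w'' t + \<beta> * (\<beta> + 1) * V t"
    "(1 - t\<^sup>2) * k' t - (\<beta> + 3) * t * k t = \<gamma> * (G t + w t * K t) * R t"
    "2 * k t - (1 - t\<^sup>2) * ((\<beta> + 3) * k t + t * k' t) = \<gamma> * (G t + w t * K t) * S t"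
proof -
  have w: "0 \<le> w t" by (rule w_nonneg[OF t])
  have b: "4 / \<beta> + 2 \<noteq> 0" "2 + 4 / \<beta> \<noteq> 0" using exponents(3) by linarith+
  have U: "ppow (1 + 2 / \<beta>) (w t) = w t * (G t)\<^sup>2"
    using ppow_Suc[OF w, of "2 / \<beta>"] \<beta> by (simp add: ppow_eq_G)
  have U': "(1 + 2 / \<beta>) * ppow (2 / \<beta>) (w t) * w' t = w' t * (G t)\<^sup>2 + 2 * w t * G t * K t * w' t"
    using G_eq[OF t] \<beta> by (simp add: ppow_eq_G field_simps power2_eq_square)
  have Z: "ppow (2 + 4 / \<beta>) (w t) = w t * Y t"
    using ppow_Suc[OF w, of "1 + 4 / \<beta>"] exponents by (simp add: Y_def add.assoc[symmetric])
  have "(2 * \<beta> + 4) * (- B / (2 + 4 / \<beta>) * (w t * Y t)) = - \<beta> * B * w t * Y t"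
  proof -
    have "2 * \<beta> + 4 = \<beta> * (2 + 4 / \<beta>)" using \<beta> by (simp add: field_simps)
    then have "(2 * \<beta> + 4) * (- B / (2 + 4 / \<beta>) * (w t * Y t))
        = \<beta> * (w t * Y t) * ((2 + 4 / \<beta>) * (- B / (2 + 4 / \<beta>)))" by simp
    also have "(2 + 4 / \<beta>) * (- B / (2 + 4 / \<beta>)) = - B" 
      by (simp only: times_divide_eq_right nonzero_mult_div_cancel_left[OF b(2)])
    finally show ?thesis by simp
  qed
  \<comment> \<open>What \<open>profile_identities\<close> calls \<open>P\<close> is
    \<open>2 * \<beta> + 4\<close> times the pressure profile, the multiple in which it occurs in
    the gradient.\<close>
  then have P: "(2 * \<beta> + 4) * P t = - \<beta> * B * w t * Y t - (\<beta> + 2) * ((w' t)\<^sup>2 + \<beta>\<^sup>2 * w t * V t) - (\<beta> + 2) * \<gamma>\<^sup>2 * (V t * (w t * (G t)\<^sup>2))"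
    unfolding P_def U Z right_diff_distrib by (simp add: field_simps)
  have P': "P' t = - B * Y t * w' t - (2 * w' t * w'' t + \<beta>\<^sup>2 * (w' t * V t + w t * V' t)) / 2
     - \<gamma>\<^sup>2 / 2 * (V' t * (w t * (G t)\<^sup>2) + V t * (w' t * (G t)\<^sup>2 + 2 * w t * G t * K t * w' t))"
    unfolding P'_def U U' ..
  note id =
    profile_identities(1,3,4,5)[where \<beta>=\<beta> and t=t and V="V t" and ?V1.0="V' t" and H="K t" and \<gamma>=\<gamma>
      and Y="Y t" and B=B]
    profile_identities(2,6,7)[where \<beta>=\<beta> and t=t and V="V t" and ?V1.0="V' t" and H="K t" and \<gamma>=\<gamma>]
  note id = id[folded w_def w'_eq, folded G_eq[OF t], folded w''_eq[OF t], folded R_def R'_def S_def S'_def k_def k'_def,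
      folded P P']
  show
    "(R t)\<^sup>2 - (k t)\<^sup>2 - ((1 - t\<^sup>2) * R t * ((\<beta> + 3) * R t + t * R' t) + S t * ((1 - t\<^sup>2) * R' t - (\<beta> + 3) * t * R t))
      - ((2 * \<beta> + 4) * P t + t * P' t) = 0"
    "2 * k t * R t - ((1 - t\<^sup>2) * R t * ((\<beta> + 3) * k t + t * k' t) + S t * ((1 - t\<^sup>2) * k' t - (\<beta> + 3) * t * k t)) = 0"
    "- 2 * R t + (1 - t\<^sup>2) * ((\<beta> + 3) * R t + t * R' t) + ((1 - t\<^sup>2) * S' t - (\<beta> + 2) * t * S t) = 0"
    "- ((\<beta> + 2) * S t + t * S' t) + ((1 - t\<^sup>2) * R' t - (\<beta> + 3) * t * R t) = w'' t + \<beta> * (\<beta> + 1) * V t"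
    "(1 - t\<^sup>2) * k' t - (\<beta> + 3) * t * k t = \<gamma> * (G t + w t * K t) * R t"
    "2 * k t - (1 - t\<^sup>2) * ((\<beta> + 3) * k t + t * k' t) = \<gamma> * (G t + w t * K t) * S t"
    using id by blast+
  show "(1 - t\<^sup>2) * R t * ((\<beta> + 2) * S t + t * S' t) + S t * ((1 - t\<^sup>2) * S' t - (\<beta> + 2) * t * S t)
      + ((1 - t\<^sup>2) * P' t - (2 * \<beta> + 4) * t * P t) = 0"
    using id(2) by (simp only: mult.commute mult.left_commute mult.assoc)
qed

text \<open>\<open>k\<close> is limited by the exponent \<open>1 / \<beta> > 1\<close>. The pressure
  sees the swirl only through its square, where the exponent is
  \<open>1 + 2 / \<beta> > 2\<close>.\<close>

lemma C_k_profiles: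
  "C_k 2 UNIV R" "C_k 2 UNIV S" "C_k 1 UNIV k" "C_k 2 UNIV P" "C_k 2 UNIV w"
proof -
  note op = open_UNIV[where 'a=real]
  have id: "C_k n UNIV (\<lambda>t::real. t)" for n by (rule C_k_bounded_linear) (rule bounded_linear_ident)
  show w: "C_k 2 UNIV w" unfolding w_def[abs_def]
    by (intro C_k_mult[OF op C_k_diff[OF op C_k_const C_k_power[OF op id]]] C_k_V)
  have pp: "C_k n UNIV (\<lambda>t. ppow a (w t))" if "real n < a" "n \<le> 2" for n a
    by (rule C_k_compose[OF op op subset_UNIV C_k_ppow[OF that(1)] C_k_le[OF w that(2)]])
  show "C_k 2 UNIV R" unfolding R_def[abs_def]
    by (intro C_k_diff[OF op] C_k_w' C_k_mult[OF op C_k_mult[OF op C_k_const id]] C_k_V)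
  show "C_k 2 UNIV S" unfolding S_def[abs_def]
    by (intro C_k_diff[OF op] C_k_mult[OF op C_k_minus[OF op id]] C_k_mult[OF op C_k_const] C_k_w' w)
  have V1: "C_k 1 UNIV V" by (rule C_k_le[OF C_k_V]) simp
  show "C_k 1 UNIV k" unfolding k_def[abs_def] G_def
    by (intro C_k_mult[OF op C_k_mult[OF op C_k_const V1]] pp) (use exponents \<beta> in auto)
  show "C_k 2 UNIV P" unfolding P_def[abs_def] divide_inverse[of "_ + _" 2]
    by (intro C_k_diff[OF op] C_k_add[OF op] C_k_mult[OF op] C_k_const C_k_power[OF op] C_k_V C_k_w' w pp)
       (use exponents \<beta> in auto)
qed

section \<open>The velocity, pressure and stream function in space\<close>

definition vel :: "real^3 \<Rightarrow> real^3" where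
  "vel = flow (hom (\<beta> + 3) R) (hom (\<beta> + 3) k) (hom (\<beta> + 2) S)"

definition press :: "real^3 \<Rightarrow> real" where
  "press = hom (2 * \<beta> + 4) P"

definition stream :: "real \<times> real \<Rightarrow> real" where
  "stream y = hom \<beta> w (vector [snd y, 0, fst y])"

lemma vel_C_k:
  "C_k 1 punctured_space vel" "C_k 2 punctured_space press"
  "C_k 2 punctured_space (poloidal vel)" "C_k 1 punctured_space (swirl vel)"
proof -
  have le: "C_k 1 punctured_space f" if "C_k 2 punctured_space f" for f :: "real^3 \<Rightarrow> real"
    by (rule C_k_le[OF that]) simp
  show "C_k 1 punctured_space vel" unfolding vel_def by (intro C_k_flow le C_k_hom C_k_profiles)
  show "C_k 2 punctured_space press" unfolding press_def by (intro C_k_hom C_k_profiles)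
  show "C_k 2 punctured_space (poloidal vel)" unfolding vel_def poloidal_flow
    by (intro C_k_flow C_k_hom C_k_profiles C_k_const)
  show "C_k 1 punctured_space (swirl vel)" unfolding vel_def swirl_flow
    by (intro C_k_flow C_k_hom C_k_profiles C_k_const)
qed

lemma homogeneous_vel: "homogeneous_pair (\<beta> + 2) vel press"
  unfolding homogeneous_pair_def
proof (intro ballI allI impI conjI)
  fix x :: "real^3" and l :: real assume l: "0 < l"
  have 3: "l powr (\<beta> + 3) = l powr (\<beta> + 2) * l"
    using powr_add[of l "\<beta> + 2" 1] l by (simp add: add.assoc)
  have "hom (\<beta> + 3) h x = l powr (\<beta> + 2) * l * hom (\<beta> + 3) h (l *\<^sub>R x)" for h
    using hom_scale[OF l, of "\<beta> + 3" h x] by (simp add: 3)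
  then show "vel x = (l powr (\<beta> + 2)) *\<^sub>R vel (l *\<^sub>R x)"
    using hom_scale[OF l, of "\<beta> + 2" S x]
    by (simp add: vec_eq_iff forall_3 vel_def algebra_simps)
  show "press x = l powr (2 * (\<beta> + 2)) * press (l *\<^sub>R x)"
    using hom_scale[OF l, of "2 * \<beta> + 4" P x] by (simp add: press_def algebra_simps)
qed

lemma axisymmetric_vel: "axisymmetric vel press"
  unfolding axisymmetric_def
proof (intro exI ballI conjI)
  fix x :: "real^3"
  show "vel x = (\<lambda>(z, r). - (r * hom (\<beta> + 3) R (vector [r, 0, z]))) (x $ 3, cyl_r x) *\<^sub>R e_r x
      + (\<lambda>(z, r). r * hom (\<beta> + 3) k (vector [r, 0, z])) (x $ 3, cyl_r x) *\<^sub>R e_phi x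
      + (\<lambda>(z, r). hom (\<beta> + 2) S (vector [r, 0, z])) (x $ 3, cyl_r x) *\<^sub>R e_z"
    unfolding vel_def flow_frame[of _ _ _ x] prod.case by (simp only: hom_meridian[symmetric])
  show "press x = (\<lambda>(z, r). hom (2 * \<beta> + 4) P (vector [r, 0, z])) (x $ 3, cyl_r x)"
    unfolding press_def prod.case by (rule hom_meridian)
qed

context
  fixes x :: "real^3" and n e t :: real
  assumes x: "x \<noteq> 0"
  defines "n \<equiv> norm x" and "e \<equiv> norm x powr (- \<beta>)" and "t \<equiv> x $ 3 / norm x"
begin

lemma t_range: "\<bar>t\<bar> \<le> 1"
  unfolding t_def using x component_le_norm_cart[of x 3] by (simp add: abs_divide)

lemma n_pos: "0 < n" using x by (simp add: n_def)

lemma powr_n: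
  "norm x powr (- (\<beta> + 3)) = e / n ^ 3" "norm x powr (- (\<beta> + 2)) = e / n\<^sup>2"
  "norm x powr (- (2 * \<beta> + 4)) = e\<^sup>2 / n ^ 4"
proof -
  have "n powr (- \<beta> - real j) = e / n ^ j" for j
    using n_pos by (simp add: e_def n_def powr_diff powr_realpow)
  from this[of 3] this[of 2] show "norm x powr (- (\<beta> + 3)) = e / n ^ 3" "norm x powr (- (\<beta> + 2)) = e / n\<^sup>2"
    by (simp_all add: n_def)
  have "norm x powr (- (2 * \<beta> + 4)) = (n powr (- \<beta> - 2))\<^sup>2"
    using n_pos by (simp add: n_def flip: powr_numeral add: powr_powr) (simp add: algebra_simps)
  also have "n powr (- \<beta> - 2) = e / n\<^sup>2" using \<open>\<And>j. n powr (- \<beta> - real j) = e / n ^ j\<close>[of 2] by simp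
  finally show "norm x powr (- (2 * \<beta> + 4)) = e\<^sup>2 / n ^ 4" by (simp add: power_divide)
qed

lemma radius_sq: "(x $ 1)\<^sup>2 + (x $ 2)\<^sup>2 = n\<^sup>2 * (1 - t\<^sup>2)"
proof -
  have "n\<^sup>2 = (x $ 1)\<^sup>2 + (x $ 2)\<^sup>2 + (x $ 3)\<^sup>2" by (simp add: n_def norm_eq_3)
  moreover have "x $ 3 = n * t" using n_pos by (simp add: n_def t_def)
  ultimately show ?thesis by (simp add: algebra_simps power_mult_distrib)
qed

lemma component_values:
  "hom (\<beta> + 3) R x = e / n ^ 3 * R t" "hom (\<beta> + 3) k x = e / n ^ 3 * k t" "hom (\<beta> + 2) S x = e / n\<^sup>2 * S t"
  "press x = e\<^sup>2 / n ^ 4 * P t"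
  unfolding hom_def press_def powr_n t_def by (rule refl)+

lemma component_derivs:
  "axi_deriv (hom (\<beta> + 3) R) (- (e / n ^ 3 / n\<^sup>2 * ((\<beta> + 3) * R t + t * R' t)))
     (e / n ^ 3 / n * ((1 - t\<^sup>2) * R' t - (\<beta> + 3) * t * R t)) x"
  "axi_deriv (hom (\<beta> + 3) k) (- (e / n ^ 3 / n\<^sup>2 * ((\<beta> + 3) * k t + t * k' t)))
     (e / n ^ 3 / n * ((1 - t\<^sup>2) * k' t - (\<beta> + 3) * t * k t)) x"
  "axi_deriv (hom (\<beta> + 2) S) (- (e / n\<^sup>2 / n\<^sup>2 * ((\<beta> + 2) * S t + t * S' t)))
     (e / n\<^sup>2 / n * ((1 - t\<^sup>2) * S' t - (\<beta> + 2) * t * S t)) x"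
  "axi_deriv press (- (e\<^sup>2 / n ^ 4 / n\<^sup>2 * ((2 * \<beta> + 4) * P t + t * P' t)))
     (e\<^sup>2 / n ^ 4 / n * ((1 - t\<^sup>2) * P' t - (2 * \<beta> + 4) * t * P t)) x"
  using axi_deriv_hom[OF x R_deriv, of "\<beta> + 3"] axi_deriv_hom[OF x k_deriv, of "\<beta> + 3"]
    axi_deriv_hom[OF x S_deriv, of "\<beta> + 2"] axi_deriv_hom[OF x P_deriv, of "2 * \<beta> + 4"]
  unfolding powr_n press_def by (simp_all only: n_def t_def)

lemma euler_at:
  "vel differentiable (at x)" "press differentiable (at x)"
  "convective vel x + grad press x = 0" "divergence vel x = 0"
proof -
  note d = component_derivs(1-3)
  have n: "n \<noteq> 0" using n_pos by simp
  note sc = scaled_identities[OF n, where e=e and t=t] and id = identities[OF t_range]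
  show "vel differentiable (at x)" unfolding vel_def by (rule differentiable_flow[OF d])
  show "press differentiable (at x)"
    using component_derivs(4) by (auto simp: axi_deriv_def intro: differentiableI)
  show "divergence vel x = 0"
    unfolding vel_def divergence_flow[OF d] component_values radius_sq sc(4) id(4) by simp
  \<comment> \<open>The first two Cartesian components combine the radial equation
    \<open>X + p = 0\<close> and the azimuthal equation \<open>Q = 0\<close> with weights
    \<open>x $ 1\<close> and \<open>x $ 2\<close>.\<close>
  have mom: "a * X + b * Q + a * p = 0" "a * X - b * Q + a * p = 0" if "X + p = 0" "Q = 0" for a b X Q p :: real
    using that by (simp_all flip: distrib_left)
  note eqs =
    sc(1)[where R="R t" and k="k t" and S="S t" and Qa="(\<beta> + 3) * R t + t * R' t"
        and Za="(1 - t\<^sup>2) * R' t - (\<beta> + 3) * t * R t" and Pa="(2 * \<beta> + 4) * P t + t * P' t",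
      unfolded id(1) mult_zero_right]
    sc(2)[where R="R t" and k="k t" and S="S t" and Qb="(\<beta> + 3) * k t + t * k' t"
        and Zb="(1 - t\<^sup>2) * k' t - (\<beta> + 3) * t * k t", unfolded id(2) mult_zero_right]
    sc(3)[where R="R t" and S="S t" and Qc="(\<beta> + 2) * S t + t * S' t"
        and Zc="(1 - t\<^sup>2) * S' t - (\<beta> + 2) * t * S t"
        and Pb="(1 - t\<^sup>2) * P' t - (2 * \<beta> + 4) * t * P t", unfolded id(3) mult_zero_right]
  show "convective vel x + grad press x = 0"
    unfolding vec_eq_iff forall_3 vel_def convective_flow[OF d] grad_axi_deriv[OF component_derivs(4)]
      vector_add_component vector_3 zero_index component_values radius_sq
    by (intro conjI mom(1)[OF eqs(1,2)] mom(2)[OF eqs(1,2)] eqs(3))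
qed

text \<open>The factor \<open>\<gamma> (G + w K) / n\<close> is the derivative of the circulation
  with respect to the stream function; the meridional part of the curl is this multiple of the
  poloidal velocity.\<close>

lemma curl_vel:
  "curl vel x = vector
    [x $ 2 * (e / n ^ 4 * (w'' t + \<beta> * (\<beta> + 1) * V t)) - x $ 1 * (e / n ^ 4 * (\<gamma> * (G t + w t * K t) * R t)),
     - (x $ 1 * (e / n ^ 4 * (w'' t + \<beta> * (\<beta> + 1) * V t))) - x $ 2 * (e / n ^ 4 * (\<gamma> * (G t + w t * K t) * R t)),
     e / n ^ 3 * (\<gamma> * (G t + w t * K t) * S t)]"
proof -
  have n: "n \<noteq> 0" using n_pos by simp
  note id = identities[OF t_range]
  have 1: "- (e / n\<^sup>2 / n\<^sup>2 * q) + e / n ^ 3 / n * z = e / n ^ 4 * (- q + z)"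
    "e / n ^ 3 / n * z = e / n ^ 4 * z"
    "2 * (e / n ^ 3 * q) + n\<^sup>2 * (1 - t\<^sup>2) * (- (e / n ^ 3 / n\<^sup>2 * z)) = e / n ^ 3 * (2 * q - (1 - t\<^sup>2) * z)" for q z
    using n by (simp_all add: field_simps eval_nat_numeral)
  show ?thesis
    unfolding vel_def curl_flow[OF component_derivs(1-3)] component_values radius_sq 1(1,3) id(5,7)
    unfolding 1(2) id(6) ..
qed

end

lemma stationary_euler_vel: "stationary_euler vel press"
  unfolding stationary_euler_def using euler_at by simp

text \<open>On the equator \<open>t = 0\<close> the azimuthal vorticity is, up to sign, the sum of
  the two nonlinear terms, positive since \<open>A + B > 0\<close>.\<close>

lemma rotational_vel: "rotational vel"
proof -
  have e: "axis 1 1 \<noteq> (0 :: real^3)" by (simp add: axis_eq_0_iff)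
  have n: "norm (axis 1 1 :: real^3) = 1" by simp
  have "curl vel (axis 1 1) $ 2 = - (w'' 0 + \<beta> * (\<beta> + 1) * V 0)"
    unfolding curl_vel[OF e] vector_3 by (simp add: n)
  also have "\<dots> = A * V 0 * ppow (2 / \<beta>) (w 0) + B * ppow (1 + 4 / \<beta>) (w 0)"
    by (simp add: w''_def)
  also have "0 < \<dots>"
  proof -
    have p: "0 < V 0 * ppow (2 / \<beta>) (w 0)" "0 < ppow (1 + 4 / \<beta>) (w 0)"
      using V_pos[of 0] w_pos[of 0] by (simp_all add: ppow_pos)
    show ?thesis using AB p by (cases "A = 0") (auto simp: mult.assoc intro: add_pos_nonneg)
  qed
  finally have "curl vel (axis 1 1) \<noteq> 0" by (metis less_irrefl zero_index)
  then show ?thesis using e by (auto simp: rotational_def)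
qed

lemma stream_polar:
  "stream (z, r) = norm (z, r) powr (- \<beta>) * w (z / norm (z, r))"
  by (simp add: stream_def hom_def norm_meridian)

lemma level_set_stream: "level_set stream C homeomorphic level_set psi0 C"
  by (rule level_set_homeomorphic_psi0[OF \<beta>(1) _ _ stream_polar])
     (use C_k_imp_continuous_on[OF C_k_profiles(5)] in \<open>auto intro: w_pos continuous_on_subset\<close>)

lemma stream_has_derivative:
  fixes r z :: real
  assumes r: "0 < r"
  defines "x \<equiv> vector [r, 0, z] :: real^3"
  shows "(stream has_derivative (\<lambda>v. (r * snd v) * hom (\<beta> + 2) S x + fst v * (r\<^sup>2 * hom (\<beta> + 3) R x))) (at (z, r))"
proof -
  have x: "x \<noteq> 0" using r by (simp add: x_def vec_eq_iff forall_3)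
  define n where "n = norm x"
  define t where "t = x $ 3 / n"
  have n: "0 < n" using x by (simp add: n_def)
  note pn = powr_n[OF x, folded n_def]
  have r2: "r\<^sup>2 = n\<^sup>2 * (1 - t\<^sup>2)" using radius_sq[OF x, folded n_def, folded t_def] by (simp add: x_def)
  note v = component_values[OF x, folded n_def, folded t_def]
  have q: "- (n powr (- \<beta>) / n\<^sup>2 * (\<beta> * w t + t * w' t)) = hom (\<beta> + 2) S x"
  proof -
    have "S t = - (\<beta> * w t + t * w' t)" by (simp add: S_def)
    then show ?thesis unfolding v by (simp only: mult_minus_right)
  qed
  have z: "n powr (- \<beta>) / n * ((1 - t\<^sup>2) * w' t - \<beta> * t * w t) = r\<^sup>2 * hom (\<beta> + 3) R x"
    unfolding v r2 R_def w_def using n by (simp add: field_simps eval_nat_numeral)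
  have "axi_deriv (hom \<beta> w) (hom (\<beta> + 2) S x) (r\<^sup>2 * hom (\<beta> + 3) R x) x"
    using axi_deriv_hom[OF x w_deriv, of \<beta>, folded n_def, folded t_def] by (simp only: q z)
  then have "(hom \<beta> w has_derivative (\<lambda>v. (x $ 1 * v $ 1 + x $ 2 * v $ 2) * hom (\<beta> + 2) S x + v $ 3 * (r\<^sup>2 * hom (\<beta> + 3) R x)))
      (at (vector [snd (z, r), 0, fst (z, r)]))"
    by (simp add: axi_deriv_def x_def)
  from has_derivative_compose[OF linear_imp_has_derivative[OF linear_meridian] this]
  show ?thesis by (simp add: stream_def[abs_def] x_def)
qed

lemma stream_function_vel: "stream_function vel stream"
  unfolding stream_function_def
proof (intro conjI allI impI)
  show "stream differentiable (at (z, r))" if "0 < r" for z r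
    using stream_has_derivative[OF that] by (rule differentiableI)
next
  fix x :: "real^3" assume r: "0 < cyl_r x"
  let ?r = "cyl_r x" and ?m = "vector [cyl_r x, 0, x $ 3] :: real^3"
  note d = stream_has_derivative[OF r, of "x $ 3"]
  have "((\<lambda>z. (z, ?r)) has_derivative (\<lambda>v. (v, 0))) (at (x $ 3))"
    by (auto intro!: derivative_eq_intros)
  from has_derivative_compose[OF this d]
  have "((\<lambda>z. stream (z, ?r)) has_real_derivative ?r\<^sup>2 * hom (\<beta> + 3) R ?m) (at (x $ 3))"
    by (simp add: has_field_derivative_def mult_commute_abs)
  then have 1: "deriv (\<lambda>z. stream (z, ?r)) (x $ 3) = ?r\<^sup>2 * hom (\<beta> + 3) R x"
    by (simp add: DERIV_imp_deriv flip: hom_meridian)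
  have "((\<lambda>r. (x $ 3, r)) has_derivative (\<lambda>v. (0, v))) (at ?r)"
    by (auto intro!: derivative_eq_intros)
  from has_derivative_compose[OF this d]
  have "((\<lambda>r. stream (x $ 3, r)) has_real_derivative ?r * hom (\<beta> + 2) S ?m) (at ?r)"
    by (simp add: has_field_derivative_def mult.assoc mult.left_commute mult_commute_abs)
  then have 2: "deriv (\<lambda>r. stream (x $ 3, r)) ?r = ?r * hom (\<beta> + 2) S x"
    by (simp add: DERIV_imp_deriv flip: hom_meridian)
  show "poloidal vel x = (- (1 / ?r) * deriv (\<lambda>z. stream (z, ?r)) (x $ 3)) *\<^sub>R e_r x
          + ((1 / ?r) * deriv (\<lambda>r. stream (x $ 3, r)) ?r) *\<^sub>R e_z"
    unfolding 1 2 vel_def poloidal_flow flow_frame[of _ _ _ x] using r by (simp add: power2_eq_square)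
next
  have w: "continuous_on UNIV w" by (rule C_k_imp_continuous_on[OF C_k_profiles(5)])
  have "continuous_on {(z, r). 0 \<le> r \<and> (z, r) \<noteq> (0, 0)} (\<lambda>y. norm y powr (- \<beta>) * w (fst y / norm y))"
    by (intro continuous_intros continuous_on_compose2[OF w]) (auto simp: zero_prod_def)
  moreover have "stream = (\<lambda>y. norm y powr (- \<beta>) * w (fst y / norm y))"
    using stream_polar by auto
  ultimately show "continuous_on {(z, r). 0 \<le> r \<and> (z, r) \<noteq> (0, 0)} stream" by simp
next
  fix z :: real assume "z \<noteq> 0"
  then have "(z / norm (z, 0::real))\<^sup>2 = 1" by (simp add: power_divide norm_Pair)
  then show "stream (z, 0) = 0" by (simp add: stream_polar w_def)
qed

section \<open>The three classes of solutions\<close>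

lemma dipole_like_solution_vel: "dipole_like_solution (\<beta> + 2) vel press"
  unfolding dipole_like_solution_def
  using stationary_euler_vel homogeneous_vel axisymmetric_vel rotational_vel
    stream_function_vel level_set_stream by blast

lemma beltrami_vel:
  assumes "B = 0"
  shows "beltrami vel"
  unfolding beltrami_def
proof
  fix x :: "real^3" assume "x \<in> punctured_space"
  then have x: "x \<noteq> 0" by simp
  define n where "n = norm x"
  define e where "e = n powr (- \<beta>)"
  define t where "t = x $ 3 / n"
  define l where "l = \<gamma> * (G t + w t * K t) / n"
  have n: "n \<noteq> 0" using x by (simp add: n_def)
  have t: "\<bar>t\<bar> \<le> 1" using t_range[OF x] by (simp add: t_def n_def)
  note v = component_values[OF x, folded n_def, folded t_def e_def]
  \<comment> \<open>Without the Bernoulli term the azimuthal vorticity is the same multiple of the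
    swirl, so the whole curl is parallel to the velocity.\<close>
  have M: "w'' t + \<beta> * (\<beta> + 1) * V t = - (\<gamma> * (G t + w t * K t) * k t)"
    unfolding w''_eq[OF t] k_def using assms by (simp add: algebra_simps power2_eq_square)
  have "curl vel x = l *\<^sub>R vel x"
    unfolding curl_vel[OF x, folded n_def, folded t_def e_def] M
    unfolding vec_eq_iff forall_3 vector_3 vector_scaleR_component vel_def flow_nth v l_def
    using n by (simp add: field_simps eval_nat_numeral)
  then show "cross3 (curl vel x) (vel x) = 0" by (simp add: cross_mult_left)
qed

context
  assumes no_swirl: "A = 0"
begin

lemma \<gamma>_eq_0: "\<gamma> = 0"
  unfolding \<gamma>_def by (simp add: no_swirl)

lemma k_eq_0: "k = (\<lambda>_. 0)"
  unfolding k_def[abs_def] \<gamma>_eq_0 by simp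

lemma without_swirl_vel: "without_swirl vel"
  by (simp add: without_swirl_def vel_def flow_inner_frame hom_def k_eq_0)

lemma vel_C_2: "C_k 2 punctured_space vel"
proof -
  have "hom (\<beta> + 3) k = (\<lambda>_. 0)" by (simp add: hom_def[abs_def] k_eq_0)
  then show ?thesis unfolding vel_def by (simp add: C_k_flow C_k_hom C_k_profiles C_k_const)
qed

lemma bernoulli_not_constant: "\<not> bernoulli vel press constant_on punctured_space"
proof
  assume "bernoulli vel press constant_on punctured_space"
  then obtain c where c: "\<And>x. x \<noteq> 0 \<Longrightarrow> bernoulli vel press x = c" by (auto simp: constant_on_def)
  \<comment> \<open>On the unit sphere the powers of \<open>|x|\<close> drop out and the kinetic
    energy cancels against the quadratic terms of \<open>P\<close>.\<close>
  have val: "bernoulli vel press x = - B / (2 + 4 / \<beta>) * ppow (2 + 4 / \<beta>) (w (x $ 3))"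
    if x: "norm x = 1" for x
  proof -
    have "x \<noteq> 0" using x by auto
    note v = component_values[OF this, unfolded x] and r = radius_sq[OF this, unfolded x]
    define Z where "Z = - B / (2 + 4 / \<beta>) * ppow (2 + 4 / \<beta>) (w (x $ 3))"
    show ?thesis
      unfolding bernoulli_def vel_def norm_flow_sq v r P_def k_eq_0 \<gamma>_eq_0 div_by_1 Z_def[symmetric]
      by (simp add: R_def S_def w_def hom_def field_simps power2_eq_square)
  qed
  \<comment> \<open>Equator against pole: \<open>w 0 > 0\<close>, whereas
    \<open>w 1 = 0\<close>.\<close>
  have "bernoulli vel press (axis 1 1) = bernoulli vel press (axis 3 1)"
    using c by (simp add: axis_eq_0_iff)
  then have "B * ppow (2 + 4 / \<beta>) (w 0) = 0"
    unfolding val[OF norm_axis_1] using exponents by (simp add: w_def)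
  moreover have "0 < ppow (2 + 4 / \<beta>) (w 0)" using w_pos[of 0] by (simp add: ppow_pos)
  ultimately show False using AB no_swirl by simp
qed

end

end

theorem theorem1p10:
  fixes \<alpha> :: real
  assumes "2 < \<alpha>" and "\<alpha> < 3"
  shows
    "(\<exists>u p. dipole_like_solution \<alpha> u p \<and> beltrami u \<and>
        C_k 1 punctured_space u \<and> C_k 1 punctured_space p \<and>
        C_k 2 punctured_space (poloidal u) \<and> C_k 2 punctured_space p \<and>
        C_k 1 punctured_space (swirl u)) \<and>
     (\<exists>u p. dipole_like_solution \<alpha> u p \<and> without_swirl u \<and>
        C_k 2 punctured_space u \<and> C_k 2 punctured_space p) \<and>
     (\<exists>u p. dipole_like_solution \<alpha> u p \<and>
        \<not> bernoulli u p constant_on punctured_space \<and>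
        C_k 1 punctured_space u \<and> C_k 1 punctured_space p \<and>
        C_k 2 punctured_space (poloidal u) \<and> C_k 2 punctured_space p \<and>
        C_k 1 punctured_space (swirl u))"
proof -
  have \<beta>: "0 < \<alpha> - 2" "\<alpha> - 2 < 1" using assms by auto
  have C1: "C_k 1 punctured_space p" if "C_k 2 punctured_space p" for p :: "real^3 \<Rightarrow> real"
    by (rule C_k_le[OF that]) simp
  obtain A V V' w' where "euler_profile (\<alpha> - 2) A 0 V V' w'"
    using euler_profile_swirl_exists[OF \<beta>] by blast
  then interpret a: euler_profile "\<alpha> - 2" A 0 V V' w' .
  obtain B V2 V2' w2' where "euler_profile (\<alpha> - 2) 0 B V2 V2' w2'"
    using euler_profile_no_swirl_exists[OF \<beta>] by blast
  then interpret b: euler_profile "\<alpha> - 2" 0 B V2 V2' w2' .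
  note a = a.dipole_like_solution_vel a.beltrami_vel[OF refl] a.vel_C_k C1[OF a.vel_C_k(2)]
  note b = b.dipole_like_solution_vel b.without_swirl_vel[OF refl] b.vel_C_2[OF refl]
    b.bernoulli_not_constant[OF refl] b.vel_C_k C1[OF b.vel_C_k(2)]
  show ?thesis using a[unfolded diff_add_cancel] b[unfolded diff_add_cancel] by blast
qed

end
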